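(* Fix $s\in\mathbb C$ and let $\mathcal E_s$ be the complex vector space of functions of $(a,c)\in(0,1)\times(0,1)$ spanned by the four functions $L^{+}(s,a,c)$, $L^{-}(s,a,c)$, $e^{-2\pi i ac}L^{+}(1-s,1-c,a)$, $e^{-2\pi i ac}L^{-}(1-s,1-c,a)$. Let $\Box=[0,1]^2$. (1) Suppose $1\le p<2$. Then all functions in $\mathcal E_s$ belong to $L^p(\Box,da\,dc)$ if and only if $1-\frac1p<\Re(s)<\frac1p$. Otherwise, no nonzero function in $\mathcal E_s$ belongs to $L^p(\Box,da\,dc)$. (2) Suppose $2\le p\le\infty$. Then for every $s\in\mathbb C$, no nonzero function in $\mathcal E_s$ belongs to $L^p(\Box,da\,dc)$.
   Context: For $0<a,c<1$ and $\Re(s)>1$ let $L^{+}(s,a,c)=\sum_{n\in\mathbb Z}e^{2\pi i n a}|n+c|^{-s}$ and $L^{-}(s,a,c)=\sum_{n\in\mathbb Z}\mathrm{sgn}(n+c)e^{2\pi i n a}|n+c|^{-s}$; equivalently $L^{\pm}(s,a,c)=\zeta(s,a,c)\pm e^{-2\pi i a}\zeta(s,1-a,1-c)$ with $\zeta(s,a,c)=\sum_{n\ge0}e^{2\pi i na}(n+c)^{-s}$. For fixed $0<a,c<1$ these extend by analytic continuation to entire functions of $s\in\mathbb C$, and $L^\pm(s,a,c)$ for arbitrary $s$ means this continuation. *)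

theory Defs
  imports
    "HOL-Complex_Analysis.Complex_Analysis"
    "HOL-Library.Function_Algebras"
begin

definition Lerch_plus_series :: "complex \<Rightarrow> real \<Rightarrow> real \<Rightarrow> complex" where
  "Lerch_plus_series s a c =
     (\<Sum>\<^sub>\<infinity>n\<in>(UNIV :: int set).
        exp (2 * pi * \<i> * of_int n * a) * complex_of_real \<bar>of_int n + c\<bar> powr (- s))"

definition Lerch_minus_series :: "complex \<Rightarrow> real \<Rightarrow> real \<Rightarrow> complex" where
  "Lerch_minus_series s a c =
     (\<Sum>\<^sub>\<infinity>n\<in>(UNIV :: int set).
        complex_of_real (sgn (of_int n + c)) * exp (2 * pi * \<i> * of_int n * a) *
        complex_of_real \<bar>of_int n + c\<bar> powr (- s))"

text \<open>The entire function that agrees with \<open>F\<close> on the half-plane \<open>Re z > 1\<close>. There is at most one,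
  by the identity theorem.\<close>

definition entire_continuation :: "(complex \<Rightarrow> complex) \<Rightarrow> complex \<Rightarrow> complex" where
  "entire_continuation F =
     (THE G. G holomorphic_on UNIV \<and> (\<forall>z. Re z > 1 \<longrightarrow> G z = F z))"

lemma entire_continuation_unique:
  assumes "G holomorphic_on UNIV" "\<And>z. Re z > 1 \<Longrightarrow> G z = F z"
    and "H holomorphic_on UNIV" "\<And>z. Re z > 1 \<Longrightarrow> H z = F z"
  shows "G = H"
proof
  fix w
  have "open {z. Re z > 1}" by (rule open_halfspace_Re_gt)
  moreover have "{z. Re z > 1} \<noteq> {}"
    using Re_complex_of_real[of 2] by (metis (mono_tags, lifting) empty_iff mem_Collect_eq one_less_numeral_iff semiring_norm(76))
  ultimately show "G w = H w"
    using assms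
    by (intro analytic_continuation_open[of "{z. Re z > 1}" UNIV G H w]) auto
qed

lemma entire_continuation_eqI:
  assumes "G holomorphic_on UNIV" "\<And>z. Re z > 1 \<Longrightarrow> G z = F z"
  shows "entire_continuation F = G"
  unfolding entire_continuation_def
proof (rule the_equality)
  show "G holomorphic_on UNIV \<and> (\<forall>z. Re z > 1 \<longrightarrow> G z = F z)"
    using assms by blast
next
  fix H assume "H holomorphic_on UNIV \<and> (\<forall>z. Re z > 1 \<longrightarrow> H z = F z)"
  then show "H = G"
    using assms by (intro entire_continuation_unique[of H F G]) simp_all
qed

definition Lerch_plus :: "complex \<Rightarrow> real \<Rightarrow> real \<Rightarrow> complex" where
  "Lerch_plus s a c = entire_continuation (\<lambda>z. Lerch_plus_series z a c) s"

definition Lerch_minus :: "complex \<Rightarrow> real \<Rightarrow> real \<Rightarrow> complex" where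
  "Lerch_minus s a c = entire_continuation (\<lambda>z. Lerch_minus_series z a c) s"

text \<open>A function on the open unit square is represented by its extension by zero to the plane, so
  that two such functions are equal iff they agree on the open square.\<close>

definition on_open_square :: "(real \<Rightarrow> real \<Rightarrow> complex) \<Rightarrow> real \<times> real \<Rightarrow> complex" where
  "on_open_square g = (\<lambda>(a, c). if 0 < a \<and> a < 1 \<and> 0 < c \<and> c < 1 then g a c else 0)"

definition fun_scale :: "complex \<Rightarrow> ('a \<Rightarrow> complex) \<Rightarrow> 'a \<Rightarrow> complex" where
  "fun_scale k f = (\<lambda>x. k * f x)"

lemma vector_space_fun_scale: "vector_space fun_scale"
  by unfold_locales (auto simp: fun_scale_def fun_eq_iff algebra_simps)

definition Lerch_space :: "complex \<Rightarrow> (real \<times> real \<Rightarrow> complex) set" where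
  "Lerch_space s = module.span fun_scale
     {on_open_square (\<lambda>a c. Lerch_plus s a c),
      on_open_square (\<lambda>a c. Lerch_minus s a c),
      on_open_square (\<lambda>a c. exp (- (2 * pi * \<i> * a * c)) * Lerch_plus (1 - s) (1 - c) a),
      on_open_square (\<lambda>a c. exp (- (2 * pi * \<i> * a * c)) * Lerch_minus (1 - s) (1 - c) a)}"

text \<open>Membership in \<open>L\<^sup>p\<close> for an extended real exponent \<open>p \<ge> 1\<close>; for \<open>p = \<infinity>\<close> it is essential
  boundedness.\<close>

definition in_Lp :: "'a measure \<Rightarrow> ereal \<Rightarrow> ('a \<Rightarrow> complex) \<Rightarrow> bool" where
  "in_Lp M p f \<longleftrightarrow> f \<in> borel_measurable M \<and>
     (if p = \<infinity> then (\<exists>C. AE x in M. norm (f x) \<le> C)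
      else integrable M (\<lambda>x. norm (f x) powr real_of_ereal p))"

definition unit_square :: "(real \<times> real) measure" where
  "unit_square = lebesgue_on ({0..1} \<times> {0..1})"

end

theory Submission
  imports Defs "HOL-Probability.Probability" "HOL-Real_Asymp.Real_Asymp"
begin

text \<open>
  For \<open>k \<in> {0, 1}\<close> let \<open>\<theta>\<^sub>k(t, a, c) = \<Sum>\<^sub>n (n + c)^k exp (2\<pi>ina) exp (- \<pi>t(n + c)\<^sup>2)\<close>. Poisson summation gives
  \<open>\<theta>\<^sub>k(1/t, a, c) = i^k t^(k + 1/2) exp (- 2\<pi>iac) \<theta>\<^sub>k(t, 1 - c, a)\<close>, and Riemann's splitting of the Mellin integral
  at \<open>t = 1\<close> shows that \<open>L\<^sup>+\<close> (\<open>k = 0\<close>) and \<open>L\<^sup>-\<close> (\<open>k = 1\<close>), multiplied by \<open>\<pi>^(-(s+k)/2) \<Gamma>((s+k)/2)\<close>, are entire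
  functions \<open>\<Lambda>\<^sub>k\<close> satisfying \<open>\<Lambda>\<^sub>k(s, a, c) = i^k exp (- 2\<pi>iac) \<Lambda>\<^sub>k(1 - s, 1 - c, a)\<close>. Hence the Lerch space consists of
  combinations of \<open>\<Lambda>\<^sub>0\<close> and \<open>\<Lambda>\<^sub>1\<close>. In the half of the integral with parameters \<open>(a, c)\<close> only the terms \<open>n = 0\<close> and
  \<open>n = -1\<close> are not uniformly bounded; for \<open>Re s > 0\<close> they contribute multiples of \<open>c^(-s)\<close> and \<open>(1 - c)^(-s)\<close>, and
  the other half contributes \<open>a^(s-1)\<close> and \<open>(1 - a)^(s-1)\<close>. The \<open>p\<close>-th powers of these are integrable
  exactly in the stated strip. Outside it, the asymptotics of almost every one-dimensional slice are not
  \<open>p\<close>-integrable, because the coefficients of a nonzero combination at the two ends of the slice cannot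
  both vanish.
\<close>


section \<open>Sums over the integers and theta series\<close>

text \<open>Since 0 < a, c < 1, neither \<open>n + c\<close> nor \<open>n + a\<close> vanishes for
  an integer n, so the theta series decay at both ends of the Mellin integral and no polar terms
  arise; this is why \<Lambda>_k is entire. In the variable u = ln t inversion becomes u \<mapsto> -
  u, complex powers of t become exp (z u) without branches, and Gamma is a Laplace transform over
  the line. Poisson summation is obtained by comparing Fourier coefficients in a, because theta is
  literally a Fourier series in that variable. The four generators carry Gamma cofactors at s and 1
  - s that may vanish, so the argument is phrased through the coefficients \<alpha>, \<beta> of
  \<Lambda>_0, \<Lambda>_1. The end coefficients of a slice are, up to a unit, the sum and the
  difference of \<alpha> and \<beta> times their Gamma factors, hence vanish together only for
  \<alpha> = \<beta> = 0. The slice asymptotics are uniform only along the slice, which is enough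
  because Fubini makes almost every slice integrable. The half-planes Re s \<ge> 1/p and Re s \<le>
  1 - 1/p are exchanged by the functional equation, which also exchanges the two directions of
  slicing.\<close>

lemma infsum_int_eq_suminf:
  fixes f :: "int \<Rightarrow> 'a::banach"
  assumes "(\<lambda>n. norm (f n)) summable_on UNIV"
  shows "summable (\<lambda>i. norm (f (int_decode i)))" "(\<Sum>\<^sub>\<infinity>n. f n) = (\<Sum>i. f (int_decode i))"
proof -
  have "(\<lambda>i. norm (f (int_decode i))) summable_on UNIV"
    using assms summable_on_reindex_bij_betw[OF bij_int_decode, of "\<lambda>n. norm (f n)"] by simp
  then show *: "summable (\<lambda>i. norm (f (int_decode i)))"
    by (rule summable_on_imp_summable)
  have "((\<lambda>i. f (int_decode i)) has_sum (\<Sum>i. f (int_decode i))) UNIV"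
    using norm_summable_imp_has_sum[OF * summable_sums[OF summable_norm_cancel[OF *]]] .
  then have "(f has_sum (\<Sum>i. f (int_decode i))) UNIV"
    using has_sum_reindex_bij_betw[OF bij_int_decode, of f] by simp
  then show "(\<Sum>\<^sub>\<infinity>n. f n) = (\<Sum>i. f (int_decode i))"
    by (rule infsumI)
qed

text \<open>Enumerating the integers by \<open>int_decode\<close> turns the sum into a series, to
  which the theorem on termwise integration applies. Every exchange of an integral with a sum over
  the integers below goes through this lemma.\<close>

lemma integral_infsum_int:
  fixes f :: "int \<Rightarrow> 'a \<Rightarrow> complex"
  assumes int: "\<And>n. integrable M (f n)"
    and sum: "\<And>x. (\<lambda>n. norm (f n x)) summable_on UNIV"
    and sumint: "(\<lambda>n. \<integral>x. norm (f n x) \<partial>M) summable_on UNIV"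
  shows "integrable M (\<lambda>x. \<Sum>\<^sub>\<infinity>n. f n x)"
    and "(\<integral>x. (\<Sum>\<^sub>\<infinity>n. f n x) \<partial>M) = (\<Sum>\<^sub>\<infinity>n. integral\<^sup>L M (f n))"
    and "(\<lambda>n. norm (integral\<^sup>L M (f n))) summable_on UNIV"
proof -
  have eq: "(\<Sum>\<^sub>\<infinity>n. f n x) = (\<Sum>i. f (int_decode i) x)" for x
    by (rule infsum_int_eq_suminf(2)[OF sum])
  have 1: "AE x in M. summable (\<lambda>i. norm (f (int_decode i) x))"
    by (intro AE_I2 infsum_int_eq_suminf(1) sum)
  have 2: "summable (\<lambda>i. \<integral>x. norm (f (int_decode i) x) \<partial>M)"
    using infsum_int_eq_suminf(1)[of "\<lambda>n. \<integral>x. norm (f n x) \<partial>M"] sumint by simp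
  show *: "(\<lambda>n. norm (integral\<^sup>L M (f n))) summable_on UNIV"
    using sumint by (rule Infinite_Sum.abs_summable_on_comparison_test') simp
  show "integrable M (\<lambda>x. \<Sum>\<^sub>\<infinity>n. f n x)"
    unfolding eq by (rule integrable_suminf[OF int 1 2])
  show "(\<integral>x. (\<Sum>\<^sub>\<infinity>n. f n x) \<partial>M) = (\<Sum>\<^sub>\<infinity>n. integral\<^sup>L M (f n))"
    unfolding eq infsum_int_eq_suminf(2)[OF *] by (rule integral_suminf[OF int 1 2])
qed

lemma summable_on_int_powr:
  fixes r :: real
  assumes "r > 1"
  shows "(\<lambda>n::int. \<bar>real_of_int n\<bar> powr (- r)) summable_on UNIV"
proof -
  have s: "(\<lambda>n::nat. real n powr (- r)) summable_on UNIV"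
    using assms by (intro norm_summable_imp_summable_on) (simp add: summable_real_powr_iff)
  have "(\<lambda>n::int. \<bar>real_of_int n\<bar> powr (- r)) summable_on (range int)"
    by (subst summable_on_reindex) (use s in \<open>simp_all add: o_def\<close>)
  moreover have "(\<lambda>n::int. \<bar>real_of_int n\<bar> powr (- r)) summable_on (range (\<lambda>n. - int n))"
    by (subst summable_on_reindex) (use s in \<open>simp_all add: o_def inj_on_def\<close>)
  moreover have "(UNIV :: int set) = range int \<union> range (\<lambda>n. - int n)"
    by (auto, metis int_cases2 rangeI)
  ultimately show ?thesis
    by (metis summable_on_union)
qed

text \<open>The excluded indices 0 and -1 are exactly those for which \<open>n + c\<close> can
  approach 0 as \<open>c\<close> runs through the unit interval; they are the source of all boundary
  singularities.\<close>

lemma int_add_unit_bounds: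
  fixes c :: real and n :: int
  assumes "n \<notin> {0, -1}" "0 \<le> c" "c \<le> 1"
  shows "1 \<le> \<bar>of_int n + c\<bar>" "\<bar>of_int n\<bar> / 2 \<le> \<bar>of_int n + c\<bar>"
proof -
  consider "n \<ge> 1" | "n \<le> -2" using assms(1) by force
  then have "1 \<le> \<bar>of_int n + c\<bar> \<and> \<bar>of_int n\<bar> / 2 \<le> \<bar>of_int n + c\<bar>"
  proof cases
    case 1
    then have "real_of_int n \<ge> 1" by simp
    then show ?thesis using assms by simp
  next
    case 2
    then have "real_of_int n \<le> -2" by simp
    then show ?thesis using assms by (simp add: abs_if)
  qed
  then show "1 \<le> \<bar>of_int n + c\<bar>" "\<bar>of_int n\<bar> / 2 \<le> \<bar>of_int n + c\<bar>" by auto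
qed

lemma summable_on_int_finite_exceptions:
  fixes f g :: "int \<Rightarrow> real"
  assumes "g summable_on UNIV" "finite F" "\<And>n. n \<notin> F \<Longrightarrow> f n \<le> g n" "\<And>n. 0 \<le> f n"
  shows "f summable_on UNIV"
proof -
  have "f summable_on (- F)"
    by (rule summable_on_comparison_test[of g])
       (use assms summable_on_subset_banach[OF assms(1), of "- F"] in auto)
  moreover have "f summable_on F" using assms(2) by (rule summable_on_finite)
  ultimately show ?thesis
    by (metis Compl_partition2 summable_on_union)
qed

lemma summable_on_int_shift_powr:
  fixes r c :: real
  assumes "r > 1" "0 \<le> c" "c \<le> 1"
  shows "(\<lambda>n::int. \<bar>of_int n + c\<bar> powr (- r)) summable_on UNIV"
proof (rule summable_on_int_finite_exceptions[where F = "{0,-1}"])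
  show "(\<lambda>n::int. 2 powr r * \<bar>of_int n\<bar> powr (- r)) summable_on UNIV"
    by (intro summable_on_cmult_right summable_on_int_powr assms)
  fix n :: int assume n: "n \<notin> {0,-1}"
  have "\<bar>of_int n + c\<bar> powr (- r) \<le> (\<bar>of_int n\<bar> / 2) powr (- r)"
    using int_add_unit_bounds[OF n assms(2,3)] n assms(1) by (intro powr_mono2') auto
  also have "\<dots> = 2 powr r * \<bar>of_int n\<bar> powr (- r)"
    by (simp add: powr_divide powr_minus field_simps)
  finally show "\<bar>of_int n + c\<bar> powr (- r) \<le> 2 powr r * \<bar>of_int n\<bar> powr (- r)" .
qed auto

lemma summable_on_int_inverse_square: "(\<lambda>n::int. 4 / (real_of_int n)^2) summable_on UNIV"
proof -
  have "(\<lambda>n::int. 4 * \<bar>real_of_int n\<bar> powr (- 2)) summable_on UNIV"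
    by (intro summable_on_cmult_right summable_on_int_powr) auto
  moreover have "4 * \<bar>real_of_int n\<bar> powr (- 2) = 4 / (real_of_int n)^2" for n
    by (cases "n = 0") (simp_all add: powr_minus powr_numeral divide_inverse)
  ultimately show ?thesis by simp
qed

section \<open>Theta terms and their Gaussian decay\<close>

definition theta_term :: "nat \<Rightarrow> real \<Rightarrow> real \<Rightarrow> real \<Rightarrow> int \<Rightarrow> complex" where
  "theta_term k t a c n =
     of_real ((of_int n + c) ^ k * exp (- (pi * t * (of_int n + c)\<^sup>2))) * exp (2 * pi * \<i> * of_int n * a)"

definition theta :: "nat \<Rightarrow> real \<Rightarrow> real \<Rightarrow> real \<Rightarrow> complex" where
  "theta k t a c = (\<Sum>\<^sub>\<infinity>n. theta_term k t a c n)"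

lemma norm_exp_2pi_i [simp]:
  "norm (exp (2 * complex_of_real pi * \<i> * of_int n * complex_of_real a)) = 1"
  "norm (exp (2 * complex_of_real pi * \<i> * complex_of_real a)) = 1"
  "norm (exp (- (2 * complex_of_real pi * \<i> * complex_of_real a * complex_of_real c))) = 1"
  by (simp_all add: norm_exp_eq_Re)

lemma norm_theta_term:
  "norm (theta_term k t a c n) = \<bar>of_int n + c\<bar> ^ k * exp (- (pi * t * (of_int n + c)\<^sup>2))"
  by (simp add: theta_term_def norm_mult norm_power abs_mult power_abs del: of_real_add of_real_mult)

lemma half_square_le_exp: "y\<^sup>2 / 2 \<le> exp y" if "y \<ge> 0" for y :: real
  using exp_lower_Taylor_quadratic[OF that] that by linarith

text \<open>Follows from exp y \<ge> y^2 / 2 with y = pi t x^2 and from |x|^k \<le> x^2. The decay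
  is only quadratic in x, but it holds for every t > 0, which is what convergence at a fixed t
  requires.\<close>

lemma gauss_weight_le:
  fixes x t :: real
  assumes "1 \<le> \<bar>x\<bar>" "t > 0" "k \<le> 1"
  shows "\<bar>x\<bar> ^ k * exp (- (pi * t * x\<^sup>2)) \<le> 1 / (t\<^sup>2 * x\<^sup>2)"
proof -
  have x2: "1 \<le> x\<^sup>2" using assms(1) by (metis abs_1 abs_le_square_iff power_one)
  have xk: "\<bar>x\<bar> ^ k \<le> x\<^sup>2"
    using power_increasing[of k 2 "\<bar>x\<bar>"] assms by simp
  have "2 * (t * x\<^sup>2)\<^sup>2 \<le> (2 * (t * x\<^sup>2))\<^sup>2 / 2" by (simp add: power2_eq_square)
  also have "\<dots> \<le> (pi * (t * x\<^sup>2))\<^sup>2 / 2"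
    using pi_gt3 assms(2) by (intro divide_right_mono power_mono mult_right_mono) auto
  also have "\<dots> \<le> exp (pi * (t * x\<^sup>2))"
    using assms(2) by (intro half_square_le_exp) auto
  finally have e: "(t * x\<^sup>2)\<^sup>2 \<le> exp (pi * t * x\<^sup>2)"
    using zero_le_power2[of "t * x\<^sup>2"] unfolding mult.assoc by linarith
  have "\<bar>x\<bar> ^ k * exp (- (pi * t * x\<^sup>2)) = \<bar>x\<bar> ^ k / exp (pi * t * x\<^sup>2)"
    by (simp add: exp_minus divide_inverse)
  also have "\<dots> \<le> x\<^sup>2 / (t * x\<^sup>2)\<^sup>2"
    using assms e xk by (intro frac_le) auto
  also have "\<dots> = 1 / (t\<^sup>2 * x\<^sup>2)"
    using x2 assms(2) by (auto simp: power2_eq_square field_simps)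
  finally show ?thesis .
qed

text \<open>Because pi > 3 and both t and x^2 are at least 1, the exponent is at least t + 2 x^2.
  The first part pays for \<open>exp (- t)\<close>, the second for a factor 1/x^4 that absorbs |x|^k
  and still leaves 1/x^2 for the summation over n.\<close>

lemma gauss_weight_le_exp:
  fixes x t :: real
  assumes "1 \<le> \<bar>x\<bar>" "t \<ge> 1" "k \<le> 1"
  shows "\<bar>x\<bar> ^ k * exp (- (pi * t * x\<^sup>2)) \<le> exp (- t) / x\<^sup>2"
proof -
  have x2: "1 \<le> x\<^sup>2" using assms(1) by (metis abs_1 abs_le_square_iff power_one)
  have xk: "\<bar>x\<bar> ^ k \<le> x\<^sup>2"
    using power_increasing[of k 2 "\<bar>x\<bar>"] assms by simp
  have "t * 1 \<le> t * x\<^sup>2" "1 * x\<^sup>2 \<le> t * x\<^sup>2"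
    using x2 assms(2) by (intro mult_left_mono mult_right_mono; simp)+
  moreover have "3 * (t * x\<^sup>2) \<le> pi * (t * x\<^sup>2)"
    using pi_gt3 assms(2) by (intro mult_right_mono) auto
  ultimately have "t + 2 * x\<^sup>2 \<le> pi * t * x\<^sup>2"
    unfolding mult.assoc by linarith
  then have e1: "exp (- (pi * t * x\<^sup>2)) \<le> exp (- t) * exp (- (2 * x\<^sup>2))"
    by (simp flip: exp_add)
  have "(x\<^sup>2)\<^sup>2 \<le> (2 * x\<^sup>2)\<^sup>2 / 2" by (simp add: power_mult_distrib)
  also have "\<dots> \<le> exp (2 * x\<^sup>2)" by (intro half_square_le_exp) auto
  finally have e: "exp (- (2 * x\<^sup>2)) \<le> 1 / (x\<^sup>2)\<^sup>2"
    using x2 by (auto simp: exp_minus divide_inverse intro!: le_imp_inverse_le)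
  have "\<bar>x\<bar> ^ k * exp (- (pi * t * x\<^sup>2)) \<le> x\<^sup>2 * (exp (- t) * (1 / (x\<^sup>2)\<^sup>2))"
    using e1 e xk by (intro mult_mono order.trans[OF e1]) auto
  also have "\<dots> = exp (- t) / x\<^sup>2"
    using x2 by (auto simp: power2_eq_square field_simps)
  finally show ?thesis .
qed

lemma inverse_square_shift_le:
  fixes c :: real
  assumes "n \<notin> {0, -1}" "0 \<le> c" "c \<le> 1"
  shows "1 / (of_int n + c)\<^sup>2 \<le> 4 / (of_int n)\<^sup>2"
proof -
  have n: "\<bar>real_of_int n\<bar> > 0" using assms by simp
  have "(\<bar>of_int n\<bar> / 2)\<^sup>2 \<le> \<bar>of_int n + c\<bar>\<^sup>2"
    using int_add_unit_bounds[OF assms] by (intro power_mono) auto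
  then have "(of_int n)\<^sup>2 / 4 \<le> (of_int n + c)\<^sup>2" by (simp add: power_divide)
  then have "1 / (of_int n + c)\<^sup>2 \<le> 1 / ((of_int n)\<^sup>2 / 4)"
    using n int_add_unit_bounds(1)[OF assms] by (intro divide_left_mono mult_pos_pos) auto
  then show ?thesis by simp
qed

lemma norm_theta_term_le:
  assumes "n \<notin> {0, -1}" "0 \<le> c" "c \<le> 1" "t > 0" "k \<le> 1"
  shows "norm (theta_term k t a c n) \<le> 1 / t\<^sup>2 * (4 / (of_int n)\<^sup>2)"
proof -
  have "norm (theta_term k t a c n) \<le> 1 / (t\<^sup>2 * (of_int n + c)\<^sup>2)"
    unfolding norm_theta_term using assms by (intro gauss_weight_le int_add_unit_bounds) auto
  also have "\<dots> = 1 / t\<^sup>2 * (1 / (of_int n + c)\<^sup>2)" by simp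
  also have "\<dots> \<le> 1 / t\<^sup>2 * (4 / (of_int n)\<^sup>2)"
    using assms by (intro mult_left_mono inverse_square_shift_le) auto
  finally show ?thesis .
qed

lemma norm_theta_term_le_exp:
  assumes "n \<notin> {0, -1}" "0 \<le> c" "c \<le> 1" "t \<ge> 1" "k \<le> 1"
  shows "norm (theta_term k t a c n) \<le> exp (- t) * (4 / (of_int n)\<^sup>2)"
proof -
  have "norm (theta_term k t a c n) \<le> exp (- t) / (of_int n + c)\<^sup>2"
    unfolding norm_theta_term using assms by (intro gauss_weight_le_exp int_add_unit_bounds) auto
  also have "\<dots> = exp (- t) * (1 / (of_int n + c)\<^sup>2)" by simp
  also have "\<dots> \<le> exp (- t) * (4 / (of_int n)\<^sup>2)"
    using assms by (intro mult_left_mono inverse_square_shift_le) auto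
  finally show ?thesis .
qed

lemma theta_term_abs_summable:
  assumes "0 \<le> c" "c \<le> 1" "t > 0" "k \<le> 1"
  shows "(\<lambda>n. norm (theta_term k t a c n)) summable_on UNIV"
proof (rule summable_on_int_finite_exceptions[where F = "{0,-1}"])
  show "(\<lambda>n. 1 / t\<^sup>2 * (4 / (real_of_int n)\<^sup>2)) summable_on UNIV"
    by (intro summable_on_cmult_right summable_on_int_inverse_square)
qed (use assms norm_theta_term_le in auto)

text \<open>Total weight of the terms other than n = 0 and n = -1, uniform in a and c. The summand
  at n = 0 is \<open>4 / 0\<close>, that is 0.\<close>

definition theta_far :: real where
  "theta_far = (\<Sum>\<^sub>\<infinity>n::int. 4 / (real_of_int n)\<^sup>2)"

lemma theta_far_nonneg: "0 \<le> theta_far"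
  unfolding theta_far_def by (intro infsum_nonneg) auto

text \<open>The bound depends on neither a nor c, also as c tends to 0 or 1. Hence every singular
  contribution near the edges of the square comes from the two removed terms.\<close>

lemma norm_theta_minus_near_le:
  assumes "0 \<le> c" "c \<le> 1" "t \<ge> 1" "k \<le> 1"
  shows "norm (theta k t a c - (theta_term k t a c 0 + theta_term k t a c (-1))) \<le> theta_far * exp (- t)"
proof -
  have abs: "(\<lambda>n. norm (theta_term k t a c n)) summable_on UNIV"
    using assms by (intro theta_term_abs_summable) auto
  then have abs': "(\<lambda>n. norm (theta_term k t a c n)) summable_on (- {0,-1})"
    by (rule summable_on_subset_banach) auto
  have s: "theta_term k t a c summable_on A" for A
    using summable_on_subset_banach[OF abs_summable_summable[OF abs]] by auto
  have "theta k t a c = infsum (theta_term k t a c) ({0,-1} \<union> - {0,-1})"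
    by (simp add: theta_def)
  also have "\<dots> = infsum (theta_term k t a c) {0,-1} + infsum (theta_term k t a c) (- {0,-1})"
    by (intro infsum_Un_disjoint s) auto
  finally have "theta k t a c - (theta_term k t a c 0 + theta_term k t a c (-1))
      = infsum (theta_term k t a c) (- {0,-1})" by simp
  also have "norm \<dots> \<le> infsum (\<lambda>n. norm (theta_term k t a c n)) (- {0,-1})"
    using abs' by (rule norm_infsum_bound)
  also have "\<dots> \<le> infsum (\<lambda>n. exp (- t) * (4 / (of_int n)\<^sup>2)) UNIV"
    using assms abs' norm_theta_term_le_exp
    by (intro infsum_mono_neutral summable_on_cmult_right summable_on_int_inverse_square) auto
  also have "\<dots> = theta_far * exp (- t)"
    unfolding theta_far_def by (subst infsum_cmult_right') simp
  finally show ?thesis .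
qed

section \<open>Fourier uniqueness and the Gaussian\<close>

lemma exp_2pi_int_mult_eq_1 [simp]: "exp (2 * complex_of_real pi * \<i> * of_int n) = 1"
  using exp_integer_2pi[OF Ints_of_int[of n]] by (simp add: mult_ac)

text \<open>Tests \<open>D\<close> against the trigonometric polynomials \<open>((1 + cos (2\<pi>(x - x0))) / 2)^N\<close>, which
  concentrate at \<open>x0\<close> as \<open>N\<close> grows.\<close>

lemma fourier_uniqueness:
  fixes D :: "real \<Rightarrow> complex"
  assumes cont: "continuous_on {0..1} D"
    and coeff: "\<And>n::int. ((\<lambda>x. D x * exp (2 * pi * \<i> * of_int n * x)) has_integral 0) {0..1}"
    and x0: "0 < x0" "x0 < 1"
  shows "D x0 = 0"
proof (rule ccontr)
  assume nz: "D x0 \<noteq> 0"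
  define e where "e = (\<lambda>(n::int) (x::real). exp (2 * pi * \<i> * of_int n * x))"
  define q where "q = exp (- (2 * pi * \<i> * x0))"
  define K where "K = (\<lambda>x. (1 + cos (2 * pi * (x - x0))) / 2)"
  \<comment> \<open>Multiplication by K shifts the frequency of a character by at most one, so
    vanishing coefficients of D propagate to D times any power of K; the induction therefore runs
    over all n at once.\<close>
  have Ke: "of_real (K x) * e n x = e n x / 2 + q / 4 * e (n + 1) x + inverse q / 4 * e (n - 1) x" for n x
  proof -
    have "of_real (K x) = 1/2 + (exp (\<i> * of_real (2 * pi * (x - x0))) + exp (- (\<i> * of_real (2 * pi * (x - x0))))) / 4"
      by (simp add: K_def cos_of_real[symmetric] cos_exp_eq del: of_real_mult of_real_diff)
    moreover have "exp (\<i> * of_real (2 * pi * (x - x0))) * e n x = q * e (n + 1) x"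
      unfolding q_def e_def exp_add[symmetric] by (rule arg_cong[where f = exp]) (simp add: algebra_simps)
    moreover have "exp (- (\<i> * of_real (2 * pi * (x - x0)))) * e n x = inverse q * e (n - 1) x"
      unfolding q_def e_def exp_add[symmetric] exp_minus[symmetric]
      by (rule arg_cong[where f = exp]) (simp add: algebra_simps)
    ultimately show ?thesis by (simp add: ring_distribs add_divide_distrib)
  qed
  have int0: "((\<lambda>x. D x * (e n x * of_real (K x ^ N))) has_integral 0) {0..1}" for n N
  proof (induction N arbitrary: n)
    case 0
    then show ?case using coeff[of n] by (simp add: e_def)
  next
    case (Suc N)
    have "((\<lambda>x. 1/2 * (D x * (e n x * of_real (K x ^ N))) + (q / 4 * (D x * (e (n+1) x * of_real (K x ^ N)))
           + inverse q / 4 * (D x * (e (n-1) x * of_real (K x ^ N))))) has_integral (1/2 * 0 + (q / 4 * 0 + inverse q / 4 * 0))) {0..1}"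
      by (intro has_integral_add has_integral_mult_right Suc)
    moreover have "1/2 * (D x * (e n x * of_real (K x ^ N))) + (q / 4 * (D x * (e (n+1) x * of_real (K x ^ N)))
           + inverse q / 4 * (D x * (e (n-1) x * of_real (K x ^ N)))) = D x * (e n x * of_real (K x ^ Suc N))" for x
    proof -
      have "D x * (e n x * of_real (K x ^ Suc N)) = D x * of_real (K x ^ N) * (of_real (K x) * e n x)"
        by (simp add: mult_ac)
      also have "\<dots> = 1/2 * (D x * (e n x * of_real (K x ^ N))) + (q / 4 * (D x * (e (n+1) x * of_real (K x ^ N)))
           + inverse q / 4 * (D x * (e (n-1) x * of_real (K x ^ N))))"
        unfolding Ke by (simp add: algebra_simps)
      finally show ?thesis by simp
    qed
    ultimately show ?case by simp
  qed
  \<comment> \<open>Multiplying by the conjugate of \<open>D x0\<close> yields a real function whose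
    value at x0 is |D x0|^2 > 0, so that signs can be compared.\<close>
  define R where "R = (\<lambda>x. Re (cnj (D x0) * D x))"
  have R0: "((\<lambda>x. R x * K x ^ N) has_integral 0) {0..1}" for N
  proof -
    have "((\<lambda>x. cnj (D x0) * (D x * (e 0 x * of_real (K x ^ N)))) has_integral (cnj (D x0) * 0)) {0..1}"
      by (intro has_integral_mult_right int0)
    from has_integral_linear[OF this bounded_linear_Re]
    have "(Re \<circ> (\<lambda>x. cnj (D x0) * (D x * (e 0 x * of_real (K x ^ N)))) has_integral 0) {0..1}" by simp
    also have "Re \<circ> (\<lambda>x. cnj (D x0) * (D x * (e 0 x * of_real (K x ^ N)))) = (\<lambda>x. R x * K x ^ N)"
    proof
      fix x
      have "cnj (D x0) * (D x * (e 0 x * of_real (K x ^ N))) = of_real (K x ^ N) * (cnj (D x0) * D x)"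
        by (simp add: e_def)
      then show "(Re \<circ> (\<lambda>x. cnj (D x0) * (D x * (e 0 x * of_real (K x ^ N))))) x = R x * K x ^ N"
        by (simp only: o_def R_def) (simp flip: of_real_power)
    qed
    finally show ?thesis .
  qed
  have contR: "continuous_on {0..1} R"
    unfolding R_def by (intro continuous_intros cont)
  define \<epsilon> where "\<epsilon> = (cmod (D x0))\<^sup>2 / 2"
  have Rx0: "R x0 = 2 * \<epsilon>"
    unfolding R_def \<epsilon>_def by (simp add: cmod_power2) (simp add: power2_eq_square)
  have e0: "\<epsilon> > 0" using nz by (simp add: \<epsilon>_def)
  obtain d where d: "d > 0" "\<And>x. x \<in> {0..1} \<Longrightarrow> dist x x0 < d \<Longrightarrow> dist (R x) (R x0) < \<epsilon>"
    using contR[unfolded continuous_on_iff, rule_format, of x0 \<epsilon>] e0 x0 by auto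
  \<comment> \<open>Besides continuity at x0, the choice keeps the window inside the unit interval
    and gives |x - x0| \<le> 1 - \<delta> for all x in it, so the kernel, which has period 1, does
    not peak a second time.\<close>
  define \<delta> where "\<delta> = min (d / 2) (min x0 (1 - x0))"
  have \<delta>: "\<delta> > 0" "\<delta> < d" "\<delta> \<le> x0" "\<delta> \<le> 1 - x0" "\<delta> \<le> 1/2" using d(1) x0 by (auto simp: \<delta>_def min_def)
  have Rpos: "R x \<ge> \<epsilon>" if "x \<in> {0..1}" "\<bar>x - x0\<bar> \<le> \<delta>" for x
    using d(2)[OF that(1)] that(2) \<delta>(2) Rx0 by (auto simp: dist_real_def abs_if split: if_splits)
  obtain B0 where B0: "\<And>x. x \<in> {0..1} \<Longrightarrow> norm (R x) \<le> B0"
    using compact_imp_bounded[OF compact_continuous_image[OF contR compact_Icc]]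
    unfolding bounded_iff by blast
  define B where "B = max B0 0"
  have B: "B \<ge> 0" "\<And>x. x \<in> {0..1} \<Longrightarrow> \<bar>R x\<bar> \<le> B" using B0 by (force simp: B_def)+
  \<comment> \<open>\<rho>1 bounds K from below on the window of radius \<delta>/2, \<rho>2 bounds
    it from above outside the window of radius \<delta>. The two different radii give the strict gap
    \<rho>2 < \<rho>1.\<close>
  define \<rho>1 where "\<rho>1 = (1 + cos (pi * \<delta>)) / 2"
  define \<rho>2 where "\<rho>2 = (1 + cos (2 * pi * \<delta>)) / 2"
  have \<rho>: "0 \<le> \<rho>2" "\<rho>2 < \<rho>1"
  proof -
    show "0 \<le> \<rho>2" unfolding \<rho>2_def using cos_ge_minus_one[of "2 * pi * \<delta>"]
      by (intro divide_nonneg_pos) linarith+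
    have "cos (2 * pi * \<delta>) < cos (pi * \<delta>)"
      using \<delta> by (intro cos_monotone_0_pi) (auto simp: mult_le_cancel_left1)
    then show "\<rho>2 < \<rho>1" by (simp add: \<rho>1_def \<rho>2_def)
  qed
  have K0: "K x \<ge> 0" for x
    unfolding K_def using cos_ge_minus_one[of "2 * pi * (x - x0)"] by (intro divide_nonneg_pos) linarith+
  have K1: "K x \<ge> \<rho>1" if "\<bar>x - x0\<bar> \<le> \<delta> / 2" for x
  proof -
    have "pi * (2 * \<bar>x - x0\<bar>) \<le> pi * \<delta>" "pi * \<delta> \<le> pi * 1"
      using that \<delta> by (intro mult_left_mono; simp)+
    then have "cos (pi * \<delta>) \<le> cos \<bar>2 * pi * (x - x0)\<bar>"
      by (intro cos_monotone_0_pi_le) (simp_all add: abs_mult)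
    then show ?thesis by (simp add: K_def \<rho>1_def)
  qed
  have K2: "K x \<le> \<rho>2" if "x \<in> {0..1}" "\<bar>x - x0\<bar> \<ge> \<delta>" for x
  proof -
    define u where "u = \<bar>x - x0\<bar>"
    have u: "\<delta> \<le> u" "u \<le> 1 - \<delta>" using that \<delta> by (auto simp: u_def)
    have "cos (2 * pi * (x - x0)) = cos \<bar>2 * pi * (x - x0)\<bar>" by simp
    also have "\<bar>2 * pi * (x - x0)\<bar> = 2 * pi * u" by (simp add: u_def abs_mult)
    also have "cos (2 * pi * u) \<le> cos (2 * pi * \<delta>)"
    proof (cases "u \<le> 1/2")
      case True
      then show ?thesis using u \<delta> by (intro cos_monotone_0_pi_le) (auto simp: field_simps)
    next
      case False
      have "cos (2 * pi * u) = cos (2 * pi * (1 - u))"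
        by (simp add: right_diff_distrib cos_diff)
      also have "pi * (2 * \<delta>) \<le> pi * (2 * (1 - u))" "pi * (2 * (1 - u)) \<le> pi * 1"
        using False u \<delta> by (intro mult_left_mono; simp)+
      then have "cos (2 * pi * (1 - u)) \<le> cos (2 * pi * \<delta>)"
        using \<delta> by (intro cos_monotone_0_pi_le) (simp_all add: mult_ac)
      finally show ?thesis .
    qed
    finally show ?thesis by (simp add: K_def \<rho>2_def)
  qed
  \<comment> \<open>The integral of R K^N is 0, yet the inner window contributes at least the left
    side, the ring between the windows is nonnegative, and the rest loses at most the right side.
    Dividing by \<rho>1^N and letting N grow forces \<epsilon> \<delta> \<le> 0.\<close>
  have key: "\<epsilon> * \<delta> * \<rho>1 ^ N \<le> B * \<rho>2 ^ N" for N
  proof -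
    define S where "S = {x0 - \<delta>/2 .. x0 + \<delta>/2}"
    have S: "S \<subseteq> {0..1}" using \<delta> by (auto simp: S_def)
    have "((\<lambda>x. if x \<in> S then \<epsilon> * \<rho>1 ^ N else 0) has_integral (\<delta> * (\<epsilon> * \<rho>1 ^ N))) {0..1}"
      using has_integral_const_real[of "\<epsilon> * \<rho>1 ^ N" "x0 - \<delta>/2" "x0 + \<delta>/2"] \<delta>
      by (subst has_integral_restrict[OF S]) (simp add: S_def)
    moreover have "((\<lambda>x. B * \<rho>2 ^ N) has_integral (B * \<rho>2 ^ N)) {0..1::real}"
      using has_integral_const_real[of "B * \<rho>2 ^ N" 0 1] by simp
    ultimately have "((\<lambda>x. (if x \<in> S then \<epsilon> * \<rho>1 ^ N else 0) - B * \<rho>2 ^ N) has_integral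
          (\<delta> * (\<epsilon> * \<rho>1 ^ N) - B * \<rho>2 ^ N)) {0..1}"
      by (rule has_integral_diff)
    then have "\<delta> * (\<epsilon> * \<rho>1 ^ N) - B * \<rho>2 ^ N \<le> 0"
    proof (rule has_integral_le[OF _ R0[of N]])
      fix x :: real assume x: "x \<in> {0..1}"
      have Bp: "0 \<le> B * \<rho>2 ^ N" using B \<rho> by simp
      consider "x \<in> S" | "x \<notin> S" "\<bar>x - x0\<bar> \<le> \<delta>" | "x \<notin> S" "\<bar>x - x0\<bar> \<ge> \<delta>" by linarith
      then show "(if x \<in> S then \<epsilon> * \<rho>1 ^ N else 0) - B * \<rho>2 ^ N \<le> R x * K x ^ N"
      proof cases
        case 1
        then have a: "\<bar>x - x0\<bar> \<le> \<delta> / 2" by (auto simp: S_def abs_if)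
        then have "\<epsilon> * \<rho>1 ^ N \<le> R x * K x ^ N"
          using Rpos[OF x] K1[OF a] e0 \<rho> \<delta> by (intro mult_mono power_mono) auto
        then show ?thesis using 1 Bp by simp
      next
        case 2
        then have "0 \<le> R x * K x ^ N" using Rpos[OF x] e0 K0[of x] by (intro mult_nonneg_nonneg) auto
        then show ?thesis using 2 Bp by simp
      next
        case 3
        have "\<bar>R x\<bar> * K x ^ N \<le> B * \<rho>2 ^ N"
          using B K2[OF x] 3 K0[of x] x by (intro mult_mono power_mono) auto
        moreover have "- \<bar>R x\<bar> * K x ^ N \<le> R x * K x ^ N"
          using K0[of x] by (intro mult_right_mono) auto
        ultimately show ?thesis using 3 by simp
      qed
    qed
    then show ?thesis by (simp add: mult_ac)
  qed
  have "(\<lambda>N. B * (\<rho>2 / \<rho>1) ^ N) \<longlonglongrightarrow> B * 0"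
    using \<rho> by (intro tendsto_mult tendsto_const LIMSEQ_power_zero) auto
  moreover have "\<epsilon> * \<delta> \<le> B * (\<rho>2 / \<rho>1) ^ N" for N
    using key[of N] \<rho> by (simp add: field_simps power_divide)
  ultimately have "\<epsilon> * \<delta> \<le> B * 0"
    by (intro LIMSEQ_le_const) auto
  then show False using mult_pos_pos[OF e0 \<delta>(1)] by simp
qed

section \<open>Fourier transforms of the Gaussian and of x times the Gaussian\<close>

lemma gauss_fourier_0:
  fixes t y :: real
  assumes t: "t > 0"
  shows "has_bochner_integral lborel
     (\<lambda>x. of_real (exp (- (pi * t * x\<^sup>2))) * exp (- (2 * pi * \<i> * x * y)))
     (of_real (exp (- (pi * y\<^sup>2 / t)) / sqrt t))"
proof -
  \<comment> \<open>r is the standard deviation of the Gaussian exp (- pi t x^2): rescaling by it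
    gives the standard normal density, whose characteristic function is known.\<close>
  define r where "r = sqrt (1 / (2 * pi * t))"
  have r: "r > 0" "r\<^sup>2 = 1 / (2 * pi * t)" using t by (simp_all add: r_def)
  have int: "integrable lborel (\<lambda>x. std_normal_density x *\<^sub>R iexp (- (2 * pi * y * r) * x))"
  proof (rule Bochner_Integration.integrable_bound)
    show "integrable lborel (\<lambda>x. std_normal_density x)" by simp
  qed (auto intro!: AE_I2)
  have "(\<integral>x. std_normal_density x *\<^sub>R iexp (- (2 * pi * y * r) * x) \<partial>lborel) = char std_normal_distribution (- (2 * pi * y * r))"
    unfolding char_def by (subst integral_density) auto
  also have "\<dots> = of_real (exp (- (2 * pi * y * r)\<^sup>2 / 2))"
    by (simp add: char_std_normal_distribution)
  also have "- (2 * pi * y * r)\<^sup>2 / 2 = - (pi * y\<^sup>2 / t)"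
    using t r(2) by (simp add: power_mult_distrib field_simps power2_eq_square)
  finally have "has_bochner_integral lborel (\<lambda>x. std_normal_density x *\<^sub>R iexp (- (2 * pi * y * r) * x))
     (of_real (exp (- (pi * y\<^sup>2 / t))))"
    using int unfolding has_bochner_integral_iff by blast
  then have "has_bochner_integral lborel (\<lambda>x. std_normal_density (0 + inverse r * x) *\<^sub>R iexp (- (2 * pi * y * r) * (0 + inverse r * x)))
     (of_real (exp (- (pi * y\<^sup>2 / t))) /\<^sub>R \<bar>inverse r\<bar>)"
    by (subst (asm) lborel_has_bochner_integral_real_affine_iff[of "inverse r" _ _ 0]) (use r(1) in auto)
  from has_bochner_integral_scaleR_right[OF this, of "sqrt (2 * pi)"]
  have *: "has_bochner_integral lborel (\<lambda>x. sqrt (2 * pi) *\<^sub>R (std_normal_density (0 + inverse r * x) *\<^sub>R iexp (- (2 * pi * y * r) * (0 + inverse r * x))))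
     (sqrt (2 * pi) *\<^sub>R (of_real (exp (- (pi * y\<^sup>2 / t))) /\<^sub>R \<bar>inverse r\<bar>))" by blast
  have "(inverse r * x)\<^sup>2 / 2 = pi * t * x\<^sup>2" for x
    using t r by (simp add: power_mult_distrib power_inverse)
  then have "sqrt (2 * pi) * std_normal_density (inverse r * x) = exp (- (pi * t * x\<^sup>2))" for x
    by (simp add: std_normal_density_def)
  moreover have "- (2 * pi * y * r) * (inverse r * x) = - (2 * pi * x * y)" for x
    using r(1) by (simp add: field_simps)
  ultimately have f: "sqrt (2 * pi) *\<^sub>R (std_normal_density (0 + inverse r * x) *\<^sub>R iexp (- (2 * pi * y * r) * (0 + inverse r * x)))
      = of_real (exp (- (pi * t * x\<^sup>2))) * exp (- (2 * pi * \<i> * x * y))" for x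
    unfolding scaleR_scaleR add_0 by (simp only:) (simp add: scaleR_conv_of_real mult_ac)
  have "sqrt (2 * pi) / \<bar>inverse r\<bar> = 1 / sqrt t"
    using r(1) t by (simp add: r_def real_sqrt_divide real_sqrt_mult field_simps)
  then have v: "sqrt (2 * pi) *\<^sub>R (of_real (exp (- (pi * y\<^sup>2 / t))) /\<^sub>R \<bar>inverse r\<bar>) = complex_of_real (exp (- (pi * y\<^sup>2 / t)) / sqrt t)"
    by (simp add: scaleR_conv_of_real divide_inverse flip: of_real_mult of_real_inverse)
  show ?thesis using * unfolding f v .
qed

lemma gauss_weight_integrable:
  fixes t y :: real
  assumes t: "t > 0" and k: "k \<le> 1"
  shows "integrable lborel (\<lambda>x. of_real (x ^ k * exp (- (pi * t * x\<^sup>2))) * exp (- (2 * pi * \<i> * x * y)))"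
proof (rule Bochner_Integration.integrable_bound)
  have "integrable lborel (\<lambda>x. norm (of_real (exp (- (pi * (t/2) * x\<^sup>2))) * exp (- (2 * pi * \<i> * x * 0))))"
    using gauss_fourier_0[of "t/2" 0] t by (intro integrable_norm) (simp add: has_bochner_integral_iff)
  then show "integrable lborel (\<lambda>x. (1 + 2 / (pi * t)) * exp (- (pi * (t/2) * x\<^sup>2)))"
    by (intro integrable_mult_right) simp
  show "AE x in lborel. norm (of_real (x ^ k * exp (- (pi * t * x\<^sup>2))) * exp (- (2 * pi * \<i> * x * y)))
      \<le> norm ((1 + 2 / (pi * t)) * exp (- (pi * (t/2) * x\<^sup>2)))"
  proof (intro AE_I2)
    fix x :: real
    \<comment> \<open>w is half of the Gaussian exponent. Both 1 and w are at most exp w, so |x|^k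
      \<le> 1 + x^2 is absorbed by one half of the exponent and the other half remains as dominating
      function; x^2 = 2 w / (pi t) explains the constant.\<close>
    define w where "w = pi * (t/2) * x\<^sup>2"
    have w: "w \<ge> 0" using t by (simp add: w_def)
    have "\<bar>x\<bar> ^ k \<le> 1 + x\<^sup>2"
    proof (cases "\<bar>x\<bar> \<le> 1")
      case True
      then show ?thesis using power_le_one[of "\<bar>x\<bar>" k] zero_le_power2[of x] by linarith
    next
      case False
      then show ?thesis using power_increasing[of k 2 "\<bar>x\<bar>"] k by simp
    qed
    also have "\<dots> = 1 + 2 / (pi * t) * w" using t by (simp add: w_def)
    also have "\<dots> \<le> 1 * exp w + 2 / (pi * t) * exp w"
      using w less_imp_le[OF exp_gt_self[of w]] t by (intro add_mono mult_left_mono) auto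
    finally have "\<bar>x\<bar> ^ k \<le> (1 + 2 / (pi * t)) * exp w" by (simp add: ring_distribs)
    then have "\<bar>x\<bar> ^ k * exp (- (2 * w)) \<le> (1 + 2 / (pi * t)) * exp w * exp (- (2 * w))"
      by (intro mult_right_mono) auto
    also have "\<dots> = (1 + 2 / (pi * t)) * exp (- w)" by (simp add: mult.assoc flip: exp_add)
    finally have "\<bar>x\<bar> ^ k * exp (- (2 * w)) \<le> (1 + 2 / (pi * t)) * exp (- w)" .
    moreover have "0 \<le> 1 + 2 / (pi * t)" using t by simp
    moreover have "2 * w = pi * t * x\<^sup>2" by (simp add: w_def)
    ultimately show "norm (of_real (x ^ k * exp (- (pi * t * x\<^sup>2))) * exp (- (2 * pi * \<i> * x * y)))
      \<le> norm ((1 + 2 / (pi * t)) * exp (- (pi * (t/2) * x\<^sup>2)))"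
      unfolding w_def[symmetric] by (simp add: norm_mult norm_power abs_mult power_abs del: of_real_mult)
  qed
qed measurable

text \<open>For k = 1 the derivative of the k = 0 integrand F is a combination of F and of the
  wanted integrand G. Its integral over the line is 0 because F decays, and this linear equation
  determines the integral of G.\<close>

lemma gauss_fourier:
  fixes t y :: real
  assumes t: "t > 0" and k: "k \<le> 1"
  shows "(\<integral>x. of_real (x ^ k * exp (- (pi * t * x\<^sup>2))) * exp (- (2 * pi * \<i> * x * y)) \<partial>lborel)
     = (- \<i> * y / t) ^ k * of_real (exp (- (pi * y\<^sup>2 / t)) / sqrt t)"
proof (cases "k = 0")
  case True
  then show ?thesis using gauss_fourier_0[OF t, of y] by (simp add: has_bochner_integral_iff)
next
  case False
  then have k: "k = 1" using k by simp
  define F where "F = (\<lambda>x. of_real (exp (- (pi * t * x\<^sup>2))) * exp (- (2 * pi * \<i> * x * y)))"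
  define G where "G = (\<lambda>x. of_real (x ^ 1 * exp (- (pi * t * x\<^sup>2))) * exp (- (2 * pi * \<i> * x * y)))"
  have F: "integrable lborel F" "integral\<^sup>L lborel F = of_real (exp (- (pi * y\<^sup>2 / t)) / sqrt t)"
    using gauss_fourier_0[OF t, of y] by (simp_all add: has_bochner_integral_iff F_def)
  have G: "integrable lborel G"
    unfolding G_def using gauss_weight_integrable[OF t, of 1 y] by simp
  define f where "f = (\<lambda>x. (- (2 * pi * t)) * G x + (- (2 * pi * \<i> * y)) * F x)"
  have f: "integrable lborel f"
    unfolding f_def by (intro Bochner_Integration.integrable_add integrable_mult_right F G)
  have Fe: "F = (\<lambda>x. exp (of_real (- (pi * t * x\<^sup>2)) - 2 * pi * \<i> * x * y))"
    unfolding F_def by (simp add: exp_diff exp_minus exp_of_real[symmetric] divide_inverse)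
  have D: "(F has_vector_derivative f x) (at x)" for x
  proof -
    have "((\<lambda>x. exp (of_real (- (pi * t * x\<^sup>2)) - 2 * pi * \<i> * x * y)) has_vector_derivative
       (of_real (- (pi * t * (2 * x))) - 2 * pi * \<i> * y) * exp (of_real (- (pi * t * x\<^sup>2)) - 2 * pi * \<i> * x * y)) (at x)"
      by (rule field_vector_diff_chain_at[where f = "\<lambda>x. of_real (- (pi * t * x\<^sup>2)) - 2 * pi * \<i> * x * y" and g = exp, unfolded o_def])
         (auto intro!: derivative_eq_intros simp: has_vector_derivative_def scaleR_conv_of_real algebra_simps)
    moreover have "G x = x * F x" by (simp add: F_def G_def)
    moreover have "(of_real (- (pi * t * (2 * x))) - 2 * pi * \<i> * y) * F x = f x"
      unfolding f_def calculation(2) by (simp add: algebra_simps)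
    ultimately show ?thesis unfolding Fe by simp
  qed
  have cont: "isCont f x" for x
    unfolding f_def F_def G_def by (intro continuous_intros)
  have nF: "norm (F x) = exp (- (pi * t * x\<^sup>2))" for x
    by (simp add: F_def norm_mult)
  have "(F \<longlongrightarrow> 0) at_top" "(F \<longlongrightarrow> 0) at_bot"
    unfolding tendsto_norm_zero_iff[symmetric, of F] nF using t by real_asymp+
  then have "(LBINT x=-\<infinity>..\<infinity>. f x) = 0 - 0"
    using f by (intro interval_integral_FTC_integrable[where F = F] D cont)
      (auto simp: ereal_tendsto_simps set_integrable_def)
  then have f0: "integral\<^sup>L lborel f = 0"
    by (simp add: interval_lebesgue_integral_def set_lebesgue_integral_def)
  have "integral\<^sup>L lborel f = (- (2 * pi * t)) * integral\<^sup>L lborel G + (- (2 * pi * \<i> * y)) * integral\<^sup>L lborel F"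
    unfolding f_def using F(1) G by (subst Bochner_Integration.integral_add) auto
  also have "\<dots> = - (2 * pi) * (t * integral\<^sup>L lborel G - (- \<i> * y * integral\<^sup>L lborel F))"
    by (simp add: algebra_simps)
  finally have "t * integral\<^sup>L lborel G = - \<i> * y * integral\<^sup>L lborel F"
    unfolding f0 by (simp add: eq_neg_iff_add_eq_0)
  then have "integral\<^sup>L lborel G = - \<i> * y / t * integral\<^sup>L lborel F"
    using t by (simp add: field_simps)
  then show ?thesis unfolding G_def F(2) k by simp
qed

section \<open>The transformation formula of the theta series\<close>

text \<open>The line is cut into the cells [m, m + 1). Summed in place, the pieces give h, since
  exactly one m equals the floor of x; translated to the unit cell, they give the periodized sum.
  Both sums are integrated termwise, with \<open>M\<close> bounding the L1 norms of the
  pieces.\<close>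

lemma integral_periodization:
  fixes h :: "real \<Rightarrow> complex"
  assumes h: "integrable lborel h"
    and M: "M summable_on UNIV" "\<And>m::int. \<And>x. 0 \<le> x \<Longrightarrow> x \<le> 1 \<Longrightarrow> norm (h (of_int m + x)) \<le> M m"
  shows "integrable lborel (\<lambda>x. indicator {0..<1} x *\<^sub>R (\<Sum>\<^sub>\<infinity>m::int. h (of_int m + x)))"
    and "(\<integral>x. indicator {0..<1} x *\<^sub>R (\<Sum>\<^sub>\<infinity>m::int. h (of_int m + x)) \<partial>lborel) = integral\<^sup>L lborel h"
proof -
  have hm [measurable]: "h \<in> borel_measurable borel" using h by (simp add: borel_measurable_integrable)
  define f where "f = (\<lambda>(m::int) x. indicator {0..<1} x *\<^sub>R h (of_int m + x))"
  define g where "g = (\<lambda>(m::int) x. indicator {of_int m..<of_int m + 1} x *\<^sub>R h x)"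
  have M0: "M m \<ge> 0" for m using order_trans[OF norm_ge_zero M(2)[of 0 m]] by simp
  have fM: "norm (f m x) \<le> indicator {0..<1} x * M m" for m x
    using M(2)[of x m] by (auto simp: f_def indicator_def)
  have fM': "norm (f m x) \<le> M m" for m x
    using fM[of m x] M0[of m] by (cases "x \<in> {0..<1}") auto
  have gf: "g m (of_int m + 1 * x) = f m x" for m x
    by (simp add: g_def f_def indicator_def)
  have g_int: "integrable lborel (g m)" for m
    unfolding g_def by (intro integrable_mult_indicator h) auto
  have f_int: "integrable lborel (f m)" for m
    using lborel_integrable_real_affine[OF g_int[of m], of 1 "of_int m"] by (simp add: gf[simplified])
  have eq: "integral\<^sup>L lborel (g m) = integral\<^sup>L lborel (f m)"
       "(\<integral>x. norm (g m x) \<partial>lborel) = (\<integral>x. norm (f m x) \<partial>lborel)" for m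
    using lborel_integral_real_affine[of 1 "g m" "of_int m"]
      lborel_integral_real_affine[of 1 "\<lambda>x. norm (g m x)" "of_int m"] by (simp_all only: gf) simp_all
  have fint_le: "(\<integral>x. norm (f m x) \<partial>lborel) \<le> M m" for m
  proof -
    have "(\<integral>x. norm (f m x) \<partial>lborel) \<le> (\<integral>x. indicator {0..<1::real} x * M m \<partial>lborel)"
      using f_int by (intro Bochner_Integration.integral_mono fM integrable_norm)
        (auto intro!: integrable_real_mult_indicator)
    then show ?thesis by (simp add: measure_def)
  qed
  have s1: "(\<lambda>m. norm (f m x)) summable_on UNIV" for x
    by (rule Infinite_Sum.abs_summable_on_comparison_test'[OF M(1)]) (rule fM')
  have s2: "(\<lambda>m. \<integral>x. norm (f m x) \<partial>lborel) summable_on UNIV"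
    by (rule summable_on_comparison_test[OF M(1)]) (use fint_le in auto)
  have gfl: "g m x = (if m = \<lfloor>x\<rfloor> then h x else 0)" for m x
    by (auto simp: g_def indicator_def floor_eq_iff) linarith+
  have s3: "(\<lambda>m. norm (g m x)) summable_on UNIV" for x
    by (rule summable_on_cong_neutral[where S = "{\<lfloor>x\<rfloor>}" and f = "\<lambda>_. norm (h x)", THEN iffD1]) (auto simp: gfl)
  have s4: "(\<lambda>m. \<integral>x. norm (g m x) \<partial>lborel) summable_on UNIV"
    unfolding eq by (rule s2)
  have gsum: "(\<Sum>\<^sub>\<infinity>m. g m x) = h x" for x
  proof -
    have "(\<Sum>\<^sub>\<infinity>m. g m x) = (\<Sum>\<^sub>\<infinity>m\<in>{\<lfloor>x\<rfloor>}. h x)"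
      by (rule infsum_cong_neutral) (auto simp: gfl)
    then show ?thesis by simp
  qed
  have fsum: "(\<Sum>\<^sub>\<infinity>m. f m x) = indicator {0..<1} x *\<^sub>R (\<Sum>\<^sub>\<infinity>m::int. h (of_int m + x))" for x
    by (cases "x \<in> {0..<1}") (auto simp: f_def)
  note F = integral_infsum_int[OF f_int s1 s2, unfolded fsum]
  note G = integral_infsum_int[OF g_int s3 s4, unfolded gsum]
  show "integrable lborel (\<lambda>x. indicator {0..<1} x *\<^sub>R (\<Sum>\<^sub>\<infinity>m::int. h (of_int m + x)))" by (rule F(1))
  show "(\<integral>x. indicator {0..<1} x *\<^sub>R (\<Sum>\<^sub>\<infinity>m::int. h (of_int m + x)) \<partial>lborel) = integral\<^sup>L lborel h"
    unfolding F(2) G(2) eq ..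
qed

text \<open>For fixed t one majorant valid for all a and all c in the closed unit interval, used for
  continuity, for periodization and for the coefficients. The value 1 at the exceptional indices is
  admissible because |n + c| \<le> 1 there.\<close>

definition theta_majorant :: "real \<Rightarrow> int \<Rightarrow> real" where
  "theta_majorant t n = (if n \<in> {0, -1} then 1 else 1 / t\<^sup>2 * (4 / (of_int n)\<^sup>2))"

lemma theta_majorant_summable: "theta_majorant t summable_on UNIV"
proof (rule summable_on_int_finite_exceptions[where F = "{0,-1}"])
  show "(\<lambda>n. 1 / t\<^sup>2 * (4 / (real_of_int n)\<^sup>2)) summable_on UNIV"
    by (intro summable_on_cmult_right summable_on_int_inverse_square)
qed (auto simp: theta_majorant_def)

lemma norm_theta_term_le_majorant:
  assumes "0 \<le> c" "c \<le> 1" "t > 0" "k \<le> 1"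
  shows "norm (theta_term k t a c n) \<le> theta_majorant t n"
proof (cases "n \<in> {0, -1}")
  case True
  then have "\<bar>of_int n + c\<bar> \<le> 1" using assms by auto
  then have "\<bar>of_int n + c\<bar> ^ k * exp (- (pi * t * (of_int n + c)\<^sup>2)) \<le> 1 * 1"
    using assms by (intro mult_mono power_le_one) auto
  then show ?thesis using True by (simp add: norm_theta_term theta_majorant_def)
next
  case False
  then show ?thesis using norm_theta_term_le[OF False assms] by (simp add: theta_majorant_def)
qed

lemma continuous_on_theta:
  assumes "continuous_on X \<alpha>" "continuous_on X \<gamma>" "\<And>x. x \<in> X \<Longrightarrow> 0 \<le> \<gamma> x \<and> \<gamma> x \<le> 1" "t > 0" "k \<le> 1"
  shows "continuous_on X (\<lambda>x. theta k t (\<alpha> x) (\<gamma> x))"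
  unfolding theta_def
proof (rule uniform_limit_theorem)
  show "uniform_limit X (\<lambda>F x. \<Sum>n\<in>F. theta_term k t (\<alpha> x) (\<gamma> x) n) (\<lambda>x. \<Sum>\<^sub>\<infinity>n. theta_term k t (\<alpha> x) (\<gamma> x) n)
      (finite_subsets_at_top UNIV)"
    by (rule Weierstrass_m_test_general[OF _ theta_majorant_summable[of t]])
       (use assms norm_theta_term_le_majorant in auto)
  show "\<forall>\<^sub>F F in finite_subsets_at_top UNIV. continuous_on X (\<lambda>x. \<Sum>n\<in>F. theta_term k t (\<alpha> x) (\<gamma> x) n)"
    unfolding theta_term_def using assms by (intro always_eventually allI continuous_intros)
qed auto

lemma integral_exp_2pi_int:
  "(\<integral>x. indicator {0..<1} x *\<^sub>R exp (2 * pi * \<i> * of_int j * complex_of_real x) \<partial>lborel) = (if j = 0 then 1 else 0)"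
proof (cases "j = 0")
  case True
  then have "(\<integral>x. indicator {0..<1} x *\<^sub>R exp (2 * pi * \<i> * of_int j * complex_of_real x) \<partial>lborel)
     = (\<integral>x. complex_of_real (indicator {0..<1::real} x) \<partial>lborel)"
    by (simp add: scaleR_conv_of_real)
  also have "\<dots> = complex_of_real (\<integral>x. indicator {0..<1::real} x \<partial>lborel)"
    by (rule integral_complex_of_real)
  also have "\<dots> = 1" by (simp add: measure_def)
  finally show ?thesis using True by simp
next
  case False
  define w where "w = 2 * pi * \<i> * of_int j"
  have w: "w \<noteq> 0" using False by (simp add: w_def)
  have "((\<lambda>x. exp (w * complex_of_real x)) has_integral (exp (w * of_real 1) / w - exp (w * of_real 0) / w)) {0..1}"
  proof (rule fundamental_theorem_of_calculus)
    fix x :: real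
    show "((\<lambda>x. exp (w * of_real x) / w) has_vector_derivative exp (w * of_real x)) (at x within {0..1})"
      using w by (auto intro!: derivative_eq_intros has_vector_derivative_real_field)
  qed simp
  moreover have "exp w = 1" by (simp add: w_def)
  ultimately have i: "((\<lambda>x. exp (w * complex_of_real x)) has_integral 0) {0..1}" by simp
  have "set_integrable lborel {0..1} (\<lambda>x. exp (w * complex_of_real x))"
    by (intro borel_integrable_atLeastAtMost' continuous_intros)
  then have "(LINT x:{0..1}|lborel. exp (w * complex_of_real x)) = 0"
    using i by (simp add: set_borel_integral_eq_integral(2) integral_unique)
  moreover have "(LINT x:{0..1}|lborel. exp (w * complex_of_real x)) = (\<integral>x. indicator {0..<1} x *\<^sub>R exp (w * complex_of_real x) \<partial>lborel)"
    unfolding set_lebesgue_integral_def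
    by (intro integral_cong_AE) (auto intro!: AE_I[where N = "{1}"] simp: indicator_def)
  ultimately show ?thesis using False by (simp add: w_def)
qed

text \<open>In its character variable theta is a Fourier series, so termwise integration and
  orthogonality read off the Gaussian weight.\<close>

lemma theta_coefficient:
  assumes "0 \<le> c" "c \<le> 1" "t > 0" "k \<le> 1"
  shows "(\<integral>x. indicator {0..<1} x *\<^sub>R (theta k t x c * exp (2 * pi * \<i> * of_int (- n) * x)) \<partial>lborel)
    = of_real ((of_int n + c) ^ k * exp (- (pi * t * (of_int n + c)\<^sup>2)))"
proof -
  define w where "w = (\<lambda>m::int. complex_of_real ((of_int m + c) ^ k * exp (- (pi * t * (of_int m + c)\<^sup>2))))"
  define f where "f = (\<lambda>m x. indicator {0..<1} x *\<^sub>R (theta_term k t x c m * exp (2 * pi * \<i> * of_int (- n) * complex_of_real x)))"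
  have f: "f m x = w m * (indicator {0..<1} x *\<^sub>R exp (2 * pi * \<i> * of_int (m - n) * complex_of_real x))" for m x
    by (simp add: f_def theta_term_def w_def ring_distribs mult_ac exp_diff exp_minus divide_inverse scaleR_conv_of_real)
  have fM: "norm (f m x) \<le> indicator {0..<1} x * theta_majorant t m" for m x
    using norm_theta_term_le_majorant[OF assms, of x m] by (auto simp: f_def indicator_def norm_mult)
  have tm0: "theta_majorant t m \<ge> 0" for m by (simp add: theta_majorant_def)
  have f_int: "integrable lborel (f m)" for m
    by (rule Bochner_Integration.integrable_bound[where f = "\<lambda>x. indicator {0..<1} x * theta_majorant t m"])
       (use fM tm0 in \<open>auto simp: f_def theta_term_def abs_mult\<close>)
  have s1: "(\<lambda>m. norm (f m x)) summable_on UNIV" for x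
    by (rule Infinite_Sum.abs_summable_on_comparison_test'[OF theta_majorant_summable[of t]])
       (use order_trans[OF fM] tm0 in \<open>auto simp: indicator_def split: if_splits\<close>)
  have fint_le: "(\<integral>x. norm (f m x) \<partial>lborel) \<le> theta_majorant t m" for m
  proof -
    have "(\<integral>x. norm (f m x) \<partial>lborel) \<le> (\<integral>x. indicator {0..<1::real} x * theta_majorant t m \<partial>lborel)"
      using f_int by (intro Bochner_Integration.integral_mono fM integrable_norm)
        (auto intro!: integrable_real_mult_indicator)
    then show ?thesis by (simp add: measure_def)
  qed
  have s2: "(\<lambda>m. \<integral>x. norm (f m x) \<partial>lborel) summable_on UNIV"
    by (rule summable_on_comparison_test[OF theta_majorant_summable[of t]]) (use fint_le in auto)
  have "(\<integral>x. indicator {0..<1} x *\<^sub>R (theta k t x c * exp (2 * pi * \<i> * of_int (- n) * x)) \<partial>lborel)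
      = (\<integral>x. (\<Sum>\<^sub>\<infinity>m. f m x) \<partial>lborel)"
    unfolding f_def theta_def
    by (simp only: infsum_cmult_left' infsum_scaleR_right)
  also have "\<dots> = (\<Sum>\<^sub>\<infinity>m. integral\<^sup>L lborel (f m))" by (rule integral_infsum_int[OF f_int s1 s2])
  also have "\<dots> = (\<Sum>\<^sub>\<infinity>m. if m = n then w n else 0)"
  proof (rule infsum_cong)
    fix m
    have "integral\<^sup>L lborel (f m) = w m * (\<integral>x. indicator {0..<1} x *\<^sub>R exp (2 * pi * \<i> * of_int (m - n) * complex_of_real x) \<partial>lborel)"
      unfolding f by (rule integral_mult_right_zero)
    then show "integral\<^sup>L lborel (f m) = (if m = n then w n else 0)"
      unfolding integral_exp_2pi_int by auto
  qed
  also have "\<dots> = (\<Sum>\<^sub>\<infinity>m\<in>{n}. w n)" by (rule infsum_cong_neutral) auto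
  finally show ?thesis by (simp add: w_def)
qed

text \<open>Connects the two kinds of coefficients: periodization produces Lebesgue integrals over
  half-open cells, \<open>fourier_uniqueness\<close> expects gauge integrals over the closed
  interval. They differ by one point.\<close>

lemma has_integral_of_lborel_half_open:
  fixes f :: "real \<Rightarrow> complex"
  assumes "continuous_on {0..1} f" "(\<integral>x. indicator {0..<1} x *\<^sub>R f x \<partial>lborel) = I"
  shows "(f has_integral I) {0..1}"
proof -
  have i: "set_integrable lborel {0..1} f"
    by (intro borel_integrable_atLeastAtMost' assms)
  have i': "set_integrable lborel {0..<1} f" by (rule set_integrable_subset[OF i]) auto
  have "(LINT x:{0..1}|lborel. f x) = (\<integral>x. indicator {0..<1} x *\<^sub>R f x \<partial>lborel)"
    unfolding set_lebesgue_integral_def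
    by (intro integral_cong_AE) (use i i' in \<open>auto intro!: AE_I[where N = "{1}"] simp: indicator_def set_integrable_def borel_measurable_integrable\<close>)
  then show ?thesis using set_borel_integral_eq_integral[OF i] assms(2)
    by (metis integrable_integral)
qed

lemma theta_shift_char: "theta k t (1 - b) c = theta k t (- b) c"
proof -
  have "theta_term k t (1 - b) c n = theta_term k t (- b) c n" for n
  proof -
    have "exp (2 * complex_of_real pi * \<i> * of_int n * of_real (1 - b)) =
        exp (2 * complex_of_real pi * \<i> * of_int n) * exp (2 * complex_of_real pi * \<i> * of_int n * of_real (- b))"
      unfolding exp_add[symmetric] by (rule arg_cong[where f = exp]) (simp add: algebra_simps)
    then show ?thesis by (simp add: theta_term_def)
  qed
  then show ?thesis by (simp add: theta_def)
qed

text \<open>Poisson summation as an equality of Fourier coefficients: c is fixed and both sides are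
  viewed as continuous functions of a. On the left the coefficient is, by periodization, the Fourier
  transform of the Gaussian weight at y = n + c; on the right it is the Gaussian weight at n + c
  with parameter 1/t.\<close>

theorem theta_transformation:
  fixes a c t :: real
  assumes a: "0 < a" "a < 1" and c: "0 \<le> c" "c \<le> 1" and t: "t > 0" and k: "k \<le> 1"
  shows "exp (- (2 * pi * \<i> * a * c)) * theta k t (1 - c) a = (- \<i> / t) ^ k / sqrt t * theta k (1 / t) a c"
proof -
  define P where "P = (\<lambda>x. exp (- (2 * pi * \<i> * x * c)) * theta k t (- c) x)"
  define A where "A = (- \<i> / complex_of_real t) ^ k / sqrt t"
  define Q where "Q = (\<lambda>x. A * theta k (1 / t) x c)"
  have contP: "continuous_on {0..1} P"
    unfolding P_def by (intro continuous_intros continuous_on_theta) (use t k in auto)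
  have contQ: "continuous_on {0..1} Q"
    unfolding Q_def by (intro continuous_intros continuous_on_theta) (use t k c in auto)
  have "P a - Q a = 0"
  proof (rule fourier_uniqueness[where D = "\<lambda>x. P x - Q x"])
    show "continuous_on {0..1} (\<lambda>x. P x - Q x)" by (intro continuous_intros contP contQ)
    fix n' :: int
    define n where "n = - n'"
    define y where "y = of_int n + c"
    define v where "v = (- \<i> * y / t) ^ k * complex_of_real (exp (- (pi * y\<^sup>2 / t)) / sqrt t)"
    define h where "h = (\<lambda>x. complex_of_real (x ^ k * exp (- (pi * t * x\<^sup>2))) * exp (- (2 * pi * \<i> * x * y)))"
    have h_int: "integrable lborel h" "integral\<^sup>L lborel h = v"
      unfolding h_def v_def using gauss_weight_integrable[OF t k] gauss_fourier[OF t k] by auto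
    \<comment> \<open>The exponential factor of h at m + x contains exp (2 pi i m n'), which is 1
      for integers. What remains is a theta term in m times a character in x.\<close>
    have h_eq: "h (of_int m + x) = theta_term k t (- c) x m * exp (- (2 * pi * \<i> * x * c)) * exp (2 * pi * \<i> * of_int n' * x)" for m x
    proof -
      have "exp (- (2 * pi * \<i> * (of_int m + x) * y)) =
          exp (2 * pi * \<i> * of_int m * (- c)) * exp (- (2 * pi * \<i> * x * c)) * exp (2 * pi * \<i> * of_int n' * x) * exp (2 * pi * \<i> * of_int (m * n'))"
        unfolding exp_add[symmetric]
        by (rule arg_cong[where f = exp]) (simp add: y_def n_def algebra_simps)
      also have "exp (2 * pi * \<i> * of_int (m * n')) = 1" using exp_2pi_int_mult_eq_1[of "m * n'"] by simp
      finally show ?thesis by (simp add: h_def theta_term_def mult_ac)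
    qed
    have "norm (h (of_int m + x)) \<le> theta_majorant t m" if "0 \<le> x" "x \<le> 1" for m x
      using norm_theta_term_le_majorant[OF that t k] by (simp add: h_eq norm_mult)
    note per = integral_periodization[OF h_int(1) theta_majorant_summable this]
    have "(\<Sum>\<^sub>\<infinity>m::int. h (of_int m + x)) = P x * exp (2 * pi * \<i> * of_int n' * x)" for x
      unfolding h_eq P_def theta_def by (simp add: infsum_cmult_left' mult_ac)
    then have 1: "((\<lambda>x. P x * exp (2 * pi * \<i> * of_int n' * x)) has_integral v) {0..1}"
      using per(2) h_int(2) by (intro has_integral_of_lborel_half_open continuous_intros contP) simp
    have "(\<integral>x. indicator {0..<1} x *\<^sub>R (Q x * exp (2 * pi * \<i> * of_int n' * x)) \<partial>lborel)
        = (\<integral>x. A * (indicator {0..<1} x *\<^sub>R (theta k (1/t) x c * exp (2 * pi * \<i> * of_int (- n) * x))) \<partial>lborel)"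
      by (simp add: Q_def n_def mult_ac)
    also have "\<dots> = A * of_real ((of_int n + c) ^ k * exp (- (pi * (1/t) * (of_int n + c)\<^sup>2)))"
      by (subst integral_mult_right_zero, subst theta_coefficient[OF c]) (use t k in auto)
    also have "\<dots> = v"
    proof -
      have "(- \<i> / complex_of_real t) ^ k * (of_int n + c) ^ k = (- \<i> * y / t) ^ k"
        by (simp only: of_real_power power_mult_distrib[symmetric] y_def) simp
      then show ?thesis by (simp add: v_def A_def y_def mult_ac)
    qed
    finally have 2: "((\<lambda>x. Q x * exp (2 * pi * \<i> * of_int n' * x)) has_integral v) {0..1}"
      by (intro has_integral_of_lborel_half_open continuous_intros contQ)
    show "((\<lambda>x. (P x - Q x) * exp (2 * pi * \<i> * of_int n' * x)) has_integral 0) {0..1}"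
      using has_integral_diff[OF 1 2] by (simp add: ring_distribs)
  qed (use a in auto)
  then show ?thesis by (simp add: P_def Q_def A_def theta_shift_char)
qed

section \<open>Mellin transforms in the logarithmic variable\<close>

lemma integrable_exp_exp_complete:
  fixes r :: real
  assumes r: "r > 0"
  shows "integrable lborel (\<lambda>u. exp (- exp u) * exp (r * u))"
proof -
  have "(\<lambda>t. complex_of_real t powr (of_real r - 1) / of_real (exp t)) absolutely_integrable_on {0<..}"
    using absolutely_integrable_Gamma_integral'[of "of_real r"] r by simp
  then have "(\<lambda>t. norm (complex_of_real t powr (of_real r - 1) / of_real (exp t))) absolutely_integrable_on {0<..}"
    by (rule absolutely_integrable_norm[unfolded o_def])
  also have "?this \<longleftrightarrow> (\<lambda>t. t powr (r - 1) / exp t) absolutely_integrable_on {0<..}"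
    by (intro set_integrable_cong) (auto simp: norm_divide norm_powr_real_powr)
  also have "{0<..} = range (exp :: real \<Rightarrow> real)"
    by (auto simp: image_iff intro!: exI[of _ "ln _"] exp_ln[symmetric])
  finally have "(\<lambda>u. \<bar>exp u\<bar> * (exp u powr (r - 1) / exp (exp u))) absolutely_integrable_on UNIV"
    by (subst (asm) absolutely_integrable_change_of_variables_1'[where h = exp])
       (auto intro!: derivative_eq_intros inj_onI)
  then have "integrable lebesgue (\<lambda>u. \<bar>exp u\<bar> * (exp u powr (r - 1) / exp (exp u)))"
    by (simp add: set_integrable_def)
  then have "integrable lborel (\<lambda>u. \<bar>exp u\<bar> * (exp u powr (r - 1) / exp (exp u)))"
    by (subst (asm) integrable_completion) auto
  moreover have "\<bar>exp u\<bar> * (exp u powr (r - 1) / exp (exp u)) = exp (- exp u) * exp (r * u)" for u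
    by (simp add: exp_powr_real exp_minus divide_inverse mult_ac flip: exp_add) (simp add: algebra_simps)
  ultimately show ?thesis by simp
qed

text \<open>Euler's integral under t = exp u: the measure dt/t becomes du and the complex power of t
  becomes exp (z u).\<close>

lemma Gamma_log_integral_1:
  fixes z :: complex
  assumes z: "Re z > 0"
  shows "has_bochner_integral lborel (\<lambda>u. of_real (exp (- exp u)) * exp (z * of_real u)) (Gamma z)"
proof -
  define f where "f = (\<lambda>t. complex_of_real t powr (z - 1) / of_real (exp t))"
  have fe: "exp u *\<^sub>R f (exp u) = of_real (exp (- exp u)) * exp (z * of_real u)" for u :: real
  proof -
    have "complex_of_real (exp u) powr (z - 1) = exp ((z - 1) * of_real u)"
      by (simp add: powr_def Ln_of_real)
    then show ?thesis
      by (simp add: f_def scaleR_conv_of_real exp_minus divide_inverse mult_ac exp_of_real[symmetric] del: exp_of_real flip: exp_add)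
         (simp add: algebra_simps)
  qed
  have int: "integrable lborel (\<lambda>u. of_real (exp (- exp u)) * exp (z * of_real u))"
    by (rule Bochner_Integration.integrable_bound[OF integrable_exp_exp_complete[OF z]])
       (auto simp: norm_mult norm_exp_eq_Re intro!: AE_I2)
  have fabs: "f absolutely_integrable_on {0<..}"
    unfolding f_def by (rule absolutely_integrable_Gamma_integral'[OF z])
  have fint: "set_integrable lborel {0<..} f"
    using fabs unfolding set_integrable_def
    by (subst (asm) integrable_completion)
       (auto simp: f_def intro!: borel_measurable_continuous_on_indicator continuous_intros)
  have "(f has_integral Gamma z) {0<..}"
    unfolding f_def by (rule Gamma_integral_complex'[OF z])
  then have "(LINT t:{0<..}|lborel. f t) = Gamma z"
    using set_borel_integral_eq_integral(2)[OF fint] by (simp add: integral_unique)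
  moreover have "(LBINT x=0..\<infinity>. f x) = (LBINT x=-\<infinity>..\<infinity>. exp x *\<^sub>R f (exp x))"
  proof (rule interval_integral_substitution_integrable)
    show "isCont f (exp x)" for x
      unfolding f_def by (intro continuous_intros) auto
    show "set_integrable lborel (einterval (-\<infinity>) \<infinity>) (\<lambda>x. exp x *\<^sub>R f (exp x))"
      unfolding fe using int by (simp add: set_integrable_def)
    show "set_integrable lborel (einterval 0 \<infinity>) f"
      using fint by (simp add: einterval_def greaterThan_def flip: zero_ereal_def)
    show "((ereal \<circ> exp \<circ> real_of_ereal) \<longlongrightarrow> 0) (at_right (- \<infinity>))"
      unfolding zero_ereal_def by (simp add: ereal_tendsto_simps exp_at_bot)
    show "((ereal \<circ> exp \<circ> real_of_ereal) \<longlongrightarrow> \<infinity>) (at_left \<infinity>)"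
      by (simp add: ereal_tendsto_simps exp_at_top)
  qed (auto intro!: derivative_eq_intros)
  ultimately have "(\<integral>u. of_real (exp (- exp u)) * exp (z * of_real u) \<partial>lborel) = Gamma z"
    unfolding fe by (simp add: interval_lebesgue_integral_def set_lebesgue_integral_def einterval_def greaterThan_def flip: zero_ereal_def)
  then show ?thesis using int by (simp add: has_bochner_integral_iff)
qed

text \<open>Scaling t by d is a translation of u by \<open>ln d\<close>; it costs the factor d^(-z),
  here written with exp and ln.\<close>

lemma Gamma_log_integral:
  fixes z :: complex and d :: real
  assumes z: "Re z > 0" and d: "d > 0"
  shows "has_bochner_integral lborel (\<lambda>u. of_real (exp (- (d * exp u))) * exp (z * of_real u))
    (exp (- (z * of_real (ln d))) * Gamma z)"
proof -
  have "has_bochner_integral lborel (\<lambda>u. of_real (exp (- exp (ln d + 1 * u))) * exp (z * of_real (ln d + 1 * u))) (Gamma z)"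
    using Gamma_log_integral_1[OF z] by (subst (asm) lborel_has_bochner_integral_real_affine_iff[of 1 _ _ "ln d"]) auto
  then have "has_bochner_integral lborel (\<lambda>u. exp (- (z * of_real (ln d))) * (of_real (exp (- exp (ln d + 1 * u))) * exp (z * of_real (ln d + 1 * u))))
     (exp (- (z * of_real (ln d))) * Gamma z)"
    by (rule has_bochner_integral_mult_right)
  moreover have "exp (- (z * of_real (ln d))) * (of_real (exp (- exp (ln d + 1 * u))) * exp (z * of_real (ln d + 1 * u)))
     = of_real (exp (- (d * exp u))) * exp (z * of_real u)" for u
    using d by (simp add: exp_add exp_minus ring_distribs mult_ac)
  ultimately show ?thesis by simp
qed

lemma Gamma_log_integral_real:
  fixes r d :: real
  assumes r: "r > 0" and d: "d > 0"
  shows "has_bochner_integral lborel (\<lambda>u. exp (- (d * exp u)) * exp (r * u)) (exp (- (r * ln d)) * Gamma r)"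
proof -
  have "has_bochner_integral lborel (\<lambda>u. Re (of_real (exp (- (d * exp u))) * exp (of_real r * of_real u)))
     (Re (exp (- (of_real r * of_real (ln d))) * Gamma (of_real r)))"
    using Gamma_log_integral[of "of_real r" d] assms
    by (intro has_bochner_integral_bounded_linear[OF bounded_linear_Re]) auto
  moreover have "of_real (exp (- (d * exp u))) * exp (of_real r * of_real u) = complex_of_real (exp (- (d * exp u)) * exp (r * u))" for u
    by (simp flip: exp_of_real)
  moreover have "exp (- (of_real r * of_real (ln d))) * Gamma (of_real r) = complex_of_real (exp (- (r * ln d)) * Gamma r)"
    by (simp add: Gamma_complex_of_real flip: exp_of_real)
  ultimately show ?thesis by simp
qed

text \<open>On u \<ge> 0 the double exponential beats every exp (r u), whatever the sign of r;
  enlarging r to \<open>max r 1\<close> brings it into the range of the Gamma integral.\<close>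

lemma integrable_exp_exp_half:
  fixes r d :: real
  assumes d: "d > 0"
  shows "integrable lborel (\<lambda>u. indicator {0..} u * (exp (- (d * exp u)) * exp (r * u)))"
proof (rule Bochner_Integration.integrable_bound)
  show "integrable lborel (\<lambda>u. exp (- (d * exp u)) * exp (max r 1 * u))"
    using Gamma_log_integral_real[of "max r 1" d] d by (simp add: has_bochner_integral_iff)
  show "AE u in lborel. norm (indicator {0..} u * (exp (- (d * exp u)) * exp (r * u))) \<le> norm (exp (- (d * exp u)) * exp (max r 1 * u))"
    by (intro AE_I2) (auto simp: indicator_def mult_right_mono)
qed auto

section \<open>Half-line Mellin integrals of theta\<close>

lemma theta_measurable:
  fixes \<upsilon> \<alpha> \<gamma> :: "'a \<Rightarrow> real"
  assumes [measurable]: "\<upsilon> \<in> borel_measurable M" "\<alpha> \<in> borel_measurable M" "\<gamma> \<in> borel_measurable M" and k: "k \<le> 1"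
  shows "(\<lambda>x. indicator {0..1} (\<gamma> x) *\<^sub>R theta k (exp (\<upsilon> x)) (\<alpha> x) (\<gamma> x)) \<in> borel_measurable M"
proof -
  \<comment> \<open>Measurability is read off the series along \<open>int_decode\<close>, which
    represents theta where absolute summability is known; the indicator restricts to that
    range.\<close>
  have eq: "indicator {0..1} (\<gamma> x) *\<^sub>R theta k (exp (\<upsilon> x)) (\<alpha> x) (\<gamma> x)
    = indicator {0..1} (\<gamma> x) *\<^sub>R (\<Sum>i. theta_term k (exp (\<upsilon> x)) (\<alpha> x) (\<gamma> x) (int_decode i))" for x
  proof (cases "\<gamma> x \<in> {0..1}")
    case True
    then show ?thesis
      unfolding theta_def using infsum_int_eq_suminf(2)[OF theta_term_abs_summable[of "\<gamma> x" "exp (\<upsilon> x)" k "\<alpha> x"]] k by simp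
  qed simp
  show ?thesis unfolding eq theta_term_def by measurable
qed

lemma theta_exp_measurable:
  assumes "0 \<le> c" "c \<le> 1" "k \<le> 1"
  shows "(\<lambda>u. theta k (exp u) a c) \<in> borel_measurable borel"
  using theta_measurable[of "\<lambda>u. u" borel "\<lambda>_. a" "\<lambda>_. c" k] assms by simp

text \<open>One summand each for n = 0, for n = -1 and for all other terms; it is independent of a.
  The factor 1 in the last exponent brings it to the form \<open>d * exp u\<close> of the Gamma
  integrals.\<close>

definition theta_bound :: "real \<Rightarrow> real \<Rightarrow> real" where
  "theta_bound c u = exp (- (pi * c\<^sup>2 * exp u)) + exp (- (pi * (1 - c)\<^sup>2 * exp u)) + theta_far * exp (- (1 * exp u))"

lemma theta_bound_nonneg: "0 \<le> theta_bound c u"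
  unfolding theta_bound_def using theta_far_nonneg by simp

lemma theta_bound_integrable:
  fixes r :: real
  assumes "0 < c" "c < 1"
  shows "integrable lborel (\<lambda>u. indicator {0..} u * (theta_bound c u * exp (r * u)))"
proof -
  have "integrable lborel (\<lambda>u. indicator {0..} u * (exp (- (pi * c\<^sup>2 * exp u)) * exp (r * u))
     + indicator {0..} u * (exp (- (pi * (1 - c)\<^sup>2 * exp u)) * exp (r * u))
     + theta_far * (indicator {0..} u * (exp (- (1 * exp u)) * exp (r * u))))"
    using assms by (intro Bochner_Integration.integrable_add integrable_mult_right integrable_exp_exp_half) auto
  then show ?thesis by (simp add: theta_bound_def algebra_simps)
qed

lemma norm_theta_le_bound:
  assumes c: "0 < c" "c < 1" and u: "u \<ge> 0" and k: "k \<le> 1"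
  shows "norm (theta k (exp u) a c) \<le> theta_bound c u"
proof -
  let ?t = "exp u"
  have "norm (theta k ?t a c) \<le> norm (theta k ?t a c - (theta_term k ?t a c 0 + theta_term k ?t a c (-1)))
     + norm (theta_term k ?t a c 0) + norm (theta_term k ?t a c (-1))"
    using norm_triangle_ineq[of "theta k ?t a c - (theta_term k ?t a c 0 + theta_term k ?t a c (-1))" "theta_term k ?t a c 0 + theta_term k ?t a c (-1)"]
      norm_triangle_ineq[of "theta_term k ?t a c 0" "theta_term k ?t a c (-1)"] by simp
  moreover have "norm (theta k ?t a c - (theta_term k ?t a c 0 + theta_term k ?t a c (-1))) \<le> theta_far * exp (- ?t)"
    using c u k by (intro norm_theta_minus_near_le) auto
  moreover have "norm (theta_term k ?t a c 0) \<le> 1 * exp (- (pi * c\<^sup>2 * ?t))"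
    unfolding norm_theta_term using c by (intro mult_mono power_le_one) (auto simp: mult_ac)
  moreover have "norm (theta_term k ?t a c (-1)) \<le> 1 * exp (- (pi * (1 - c)\<^sup>2 * ?t))"
    unfolding norm_theta_term using c by (intro mult_mono power_le_one) (auto simp: mult_ac power2_commute)
  ultimately show ?thesis by (simp add: theta_bound_def)
qed

text \<open>With \<open>t = exp u\<close> the inversion \<open>t \<mapsto> 1 / t\<close> becomes \<open>u \<mapsto> - u\<close>, so this is the Mellin integral of the
  theta series over \<open>t \<ge> 1\<close>.\<close>

definition half_mellin :: "nat \<Rightarrow> complex \<Rightarrow> real \<Rightarrow> real \<Rightarrow> complex" where
  "half_mellin k z a c = (\<integral>u. indicator {0..} u *\<^sub>R (theta k (exp u) a c * exp (z * of_real u)) \<partial>lborel)"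

lemma norm_half_mellin_integrand_le:
  assumes "0 < c" "c < 1" "k \<le> 1"
  shows "norm (indicator {0..} u *\<^sub>R (theta k (exp u) a c * exp (z * of_real u))) \<le> indicator {0..} u * (theta_bound c u * exp (Re z * u))"
  using norm_theta_le_bound[OF assms(1,2) _ assms(3), of u a]
  by (auto simp: indicator_def norm_mult norm_exp_eq_Re intro!: mult_right_mono)

lemma half_mellin_integrable:
  assumes "0 < c" "c < 1" "k \<le> 1"
  shows "integrable lborel (\<lambda>u. indicator {0..} u *\<^sub>R (theta k (exp u) a c * exp (z * of_real u)))"
proof (rule Bochner_Integration.integrable_bound[OF theta_bound_integrable[OF assms(1,2), of "Re z"]])
  show "(\<lambda>u. indicator {0..} u *\<^sub>R (theta k (exp u) a c * exp (z * of_real u))) \<in> borel_measurable lborel"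
  proof -
    have [measurable]: "(\<lambda>u. theta k (exp u) a c) \<in> borel_measurable borel"
      by (rule theta_exp_measurable) (use assms in auto)
    show ?thesis by measurable
  qed
  show "AE u in lborel. norm (indicator {0..} u *\<^sub>R (theta k (exp u) a c * exp (z * of_real u)))
      \<le> norm (indicator {0..} u * (theta_bound c u * exp (Re z * u)))"
    using norm_half_mellin_integrand_le[OF assms] theta_bound_nonneg by (auto intro!: AE_I2 simp: abs_mult)
qed

lemma norm_half_mellin_le:
  assumes "0 < c" "c < 1" "k \<le> 1"
  shows "norm (half_mellin k z a c) \<le> (\<integral>u. indicator {0..} u * (theta_bound c u * exp (Re z * u)) \<partial>lborel)"
  unfolding half_mellin_def
  by (rule order.trans[OF integral_norm_bound])
     (intro Bochner_Integration.integral_mono integrable_norm half_mellin_integrable theta_bound_integrable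
        norm_half_mellin_integrand_le assms)

text \<open>Expanding \<open>exp (z u)\<close> and integrating termwise yields an everywhere convergent power series.\<close>

lemma laplace_transform_entire:
  fixes g :: "real \<Rightarrow> complex"
  assumes [measurable]: "g \<in> borel_measurable borel"
    and int: "\<And>r. integrable lborel (\<lambda>u. norm (g u) * exp (r * \<bar>u\<bar>))"
  shows "(\<lambda>z. \<integral>u. g u * exp (z * of_real u) \<partial>lborel) holomorphic_on UNIV"
proof -
  define F where "F = (\<lambda>z. \<integral>u. g u * exp (z * of_real u) \<partial>lborel)"
  define b where "b = (\<lambda>n. \<integral>u. g u * (of_real u ^ n /\<^sub>R fact n) \<partial>lborel)"
  have sums: "(\<lambda>n. b n * z ^ n) sums F z" for z
  proof -
    define f where "f = (\<lambda>n u. g u * ((z * of_real u) ^ n /\<^sub>R fact n))"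
    have nf: "norm (f n u) = norm (g u) * ((norm z * \<bar>u\<bar>) ^ n /\<^sub>R fact n)" for n u
      by (simp add: f_def norm_mult norm_power)
    have se: "(\<lambda>n. (norm z * \<bar>u\<bar>) ^ n /\<^sub>R fact n) sums exp (norm z * \<bar>u\<bar>)" for u :: real
      by (rule exp_converges)
    \<comment> \<open>This bound serves twice: it dominates each single term, and it bounds the
      partial sums of the integrated norms.\<close>
    have partial: "(\<Sum>i<n. norm (f i u)) \<le> norm (g u) * exp (norm z * \<bar>u\<bar>)" for n u
    proof -
      have "(\<Sum>i<n. norm (f i u)) = norm (g u) * (\<Sum>i<n. (norm z * \<bar>u\<bar>) ^ i /\<^sub>R fact i)"
        unfolding nf by (simp add: sum_distrib_left)
      also have "\<dots> \<le> norm (g u) * exp (norm z * \<bar>u\<bar>)"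
        using sum_le_suminf[OF sums_summable[OF se[of u]], of "{..<n}"] sums_unique[OF se[of u]]
        by (intro mult_left_mono) (auto simp del: fact_Suc)
      finally show ?thesis .
    qed
    have f_int: "integrable lborel (f n)" for n
    proof (rule Bochner_Integration.integrable_bound[OF int[of "norm z"]])
      show "f n \<in> borel_measurable lborel" unfolding f_def by measurable
      show "AE u in lborel. norm (f n u) \<le> norm (norm (g u) * exp (norm z * \<bar>u\<bar>))"
      proof (intro AE_I2)
        fix u
        have "norm (f n u) \<le> (\<Sum>i<Suc n. norm (f i u))" by (simp add: sum_nonneg)
        also have "\<dots> \<le> norm (g u) * exp (norm z * \<bar>u\<bar>)" by (rule partial)
        finally show "norm (f n u) \<le> norm (norm (g u) * exp (norm z * \<bar>u\<bar>))" by simp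
      qed
    qed
    have s1: "AE u in lborel. summable (\<lambda>n. norm (f n u))"
      unfolding nf by (intro AE_I2 summable_mult sums_summable[OF se])
    have s2: "summable (\<lambda>n. \<integral>u. norm (f n u) \<partial>lborel)"
    proof (rule summableI_nonneg_bounded)
      fix n
      have "(\<Sum>i<n. \<integral>u. norm (f i u) \<partial>lborel) = (\<integral>u. (\<Sum>i<n. norm (f i u)) \<partial>lborel)"
        using f_int by (subst Bochner_Integration.integral_sum) auto
      also have "\<dots> \<le> (\<integral>u. norm (g u) * exp (norm z * \<bar>u\<bar>) \<partial>lborel)"
        using f_int by (intro Bochner_Integration.integral_mono int partial Bochner_Integration.integrable_sum integrable_norm) auto
      finally show "(\<Sum>i<n. \<integral>u. norm (f i u) \<partial>lborel) \<le> (\<integral>u. norm (g u) * exp (norm z * \<bar>u\<bar>) \<partial>lborel)" .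
    qed auto
    have "(\<lambda>n. integral\<^sup>L lborel (f n)) sums (\<integral>u. (\<Sum>n. f n u) \<partial>lborel)"
      by (rule sums_integral[OF f_int s1 s2])
    also have "(\<lambda>u. \<Sum>n. f n u) = (\<lambda>u. g u * exp (z * of_real u))"
    proof
      fix u
      show "(\<Sum>n. f n u) = g u * exp (z * of_real u)"
        unfolding f_def using sums_mult[OF exp_converges[of "z * of_real u"], of "g u"] by (rule sums_unique[symmetric])
    qed
    also have "(\<lambda>n. integral\<^sup>L lborel (f n)) = (\<lambda>n. b n * z ^ n)"
    proof
      fix n
      have "integral\<^sup>L lborel (f n) = (\<integral>u. (g u * (of_real u ^ n /\<^sub>R fact n)) * z ^ n \<partial>lborel)"
        by (simp add: f_def power_mult_distrib scaleR_conv_of_real mult_ac)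
      then show "integral\<^sup>L lborel (f n) = b n * z ^ n" by (simp add: b_def)
    qed
    finally show ?thesis by (simp add: F_def)
  qed
  have "F holomorphic_on ball 0 r" for r
    by (rule power_series_holomorphic[where a = b]) (use sums in simp)
  then have "F field_differentiable (at z)" for z
    by (metis holomorphic_on_imp_differentiable_at open_ball mem_ball_0 less_add_one)
  then have "F holomorphic_on UNIV"
    by (simp add: holomorphic_on_def)
  then show ?thesis by (simp add: F_def)
qed

lemma half_mellin_entire:
  assumes "0 < c" "c < 1" "k \<le> 1"
  shows "(\<lambda>z. half_mellin k z a c) holomorphic_on UNIV"
proof -
  have [measurable]: "(\<lambda>u. theta k (exp u) a c) \<in> borel_measurable borel"
    by (rule theta_exp_measurable) (use assms in auto)
  have "(\<lambda>z. \<integral>u. (indicator {0..} u *\<^sub>R theta k (exp u) a c) * exp (z * of_real u) \<partial>lborel) holomorphic_on UNIV"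
  proof (rule laplace_transform_entire)
    show "(\<lambda>u. indicator {0..} u *\<^sub>R theta k (exp u) a c) \<in> borel_measurable borel"
      by measurable
    fix r :: real
    have "integrable lborel (\<lambda>u. norm (indicator {0..} u *\<^sub>R (theta k (exp u) a c * exp (of_real r * of_real u))))"
      by (intro integrable_norm half_mellin_integrable assms)
    moreover have "norm (indicator {0..} u *\<^sub>R (theta k (exp u) a c * exp (of_real r * of_real u))) =
       norm (indicator {0..} u *\<^sub>R theta k (exp u) a c) * exp (r * \<bar>u\<bar>)" for u
      by (auto simp: indicator_def norm_mult norm_exp_eq_Re)
    ultimately show "integrable lborel (\<lambda>u. norm (indicator {0..} u *\<^sub>R theta k (exp u) a c) * exp (r * \<bar>u\<bar>))"
      by (simp only:)
  qed
  then show ?thesis by (simp add: half_mellin_def)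
qed

section \<open>The completed functions and their functional equation\<close>

text \<open>Riemann's splitting taken as a definition for all s: the second summand is the part over
  t < 1, already carried to t > 1 by the transformation of theta.\<close>

definition completed_Lerch :: "nat \<Rightarrow> complex \<Rightarrow> real \<Rightarrow> real \<Rightarrow> complex" where
  "completed_Lerch k s a c = half_mellin k ((s + of_nat k) / 2) a c
     + \<i> ^ k * exp (- (2 * pi * \<i> * a * c)) * half_mellin k ((1 - s + of_nat k) / 2) (1 - c) a"

text \<open>Reindexing by n \<mapsto> - n - 1 negates \<open>n + c\<close>. The formula is needed
  because the substitution (a, c) \<mapsto> (1 - c, a), applied twice, gives (1 - a, 1 - c) and not
  (a, c).\<close>

lemma theta_reflect: "theta k t (1 - a) (1 - c) = (- 1) ^ k * exp (2 * pi * \<i> * a) * theta k t a c"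
proof -
  have "theta_term k t (1 - a) (1 - c) (- n - 1) = (- 1) ^ k * exp (2 * pi * \<i> * a) * theta_term k t a c n" for n
  proof -
    have x: "real_of_int (- n - 1) + (1 - c) = - (of_int n + c)" by simp
    have "exp (2 * pi * \<i> * of_int (- n - 1) * of_real (1 - a)) =
        exp (2 * pi * \<i> * of_int (- n - 1)) * (exp (2 * pi * \<i> * a) * exp (2 * pi * \<i> * of_int n * a))"
      unfolding exp_add[symmetric] by (rule arg_cong[where f = exp]) (simp add: algebra_simps)
    also have "exp (2 * pi * \<i> * of_int (- n - 1)) = 1" using exp_2pi_int_mult_eq_1[of "- n - 1"] by simp
    finally have e: "exp (2 * pi * \<i> * of_int (- n - 1) * of_real (1 - a)) =
       exp (2 * pi * \<i> * a) * exp (2 * pi * \<i> * of_int n * a)" by simp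
    show ?thesis
      unfolding theta_term_def x e power2_minus by (subst power_minus) (simp add: mult_ac)
  qed
  then have "(\<Sum>\<^sub>\<infinity>n. theta_term k t (1 - a) (1 - c) (- n - 1)) = (- 1) ^ k * exp (2 * pi * \<i> * a) * theta k t a c"
    by (simp only: theta_def infsum_cmult_right')
  moreover have "(\<Sum>\<^sub>\<infinity>n. theta_term k t (1 - a) (1 - c) (- n - 1)) = theta k t (1 - a) (1 - c)"
    unfolding theta_def
    by (rule infsum_reindex_bij_betw) (auto intro!: bij_betwI[where g = "\<lambda>n. - n - 1"])
  ultimately show ?thesis by simp
qed

lemma half_mellin_reflect:
  "half_mellin k z (1 - a) (1 - c) = (- 1) ^ k * exp (2 * pi * \<i> * a) * half_mellin k z a c"
proof -
  have "half_mellin k z (1 - a) (1 - c) = (\<integral>u. (- 1) ^ k * exp (2 * pi * \<i> * a) *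
      (indicator {0..} u *\<^sub>R (theta k (exp u) a c * exp (z * of_real u))) \<partial>lborel)"
    unfolding half_mellin_def theta_reflect by (simp add: mult_ac)
  also have "\<dots> = (- 1) ^ k * exp (2 * pi * \<i> * a) * half_mellin k z a c"
    unfolding half_mellin_def by (rule integral_mult_right_zero)
  finally show ?thesis .
qed

text \<open>The substitution interchanges the two halves of the definition. One half returns
  directly, the other up to the reflection formula, whose sign and character cancel against i^k i^k
  and the two exponentials.\<close>

theorem completed_Lerch_functional_equation:
  "completed_Lerch k s a c = \<i> ^ k * exp (- (2 * pi * \<i> * a * c)) * completed_Lerch k (1 - s) (1 - c) a"
proof -
  have k: "\<i> ^ k * \<i> ^ k * (- 1) ^ k = (1::complex)"
    by (simp flip: power_mult_distrib)
  have e: "exp (- (2 * pi * \<i> * a * c)) * (exp (- (2 * pi * \<i> * (1 - c) * a)) * exp (2 * pi * \<i> * a)) = 1"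
    unfolding exp_add[symmetric] by (rule trans[OF arg_cong[where f = exp and y = 0]]) (simp_all add: algebra_simps)
  have "\<i> ^ k * exp (- (2 * pi * \<i> * a * c)) * completed_Lerch k (1 - s) (1 - c) a
     = \<i> ^ k * exp (- (2 * pi * \<i> * a * c)) * half_mellin k ((1 - s + of_nat k) / 2) (1 - c) a
     + (\<i> ^ k * \<i> ^ k * (- 1) ^ k) * (exp (- (2 * pi * \<i> * a * c)) * (exp (- (2 * pi * \<i> * (1 - c) * a)) * exp (2 * pi * \<i> * a))) *
        half_mellin k ((s + of_nat k) / 2) a c"
    unfolding completed_Lerch_def half_mellin_reflect by (simp add: algebra_simps)
  then show ?thesis unfolding k e by (simp add: completed_Lerch_def)
qed

lemma completed_Lerch_entire:
  assumes "0 < a" "a < 1" "0 < c" "c < 1" "k \<le> 1"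
  shows "(\<lambda>s. completed_Lerch k s a c) holomorphic_on UNIV"
proof -
  have "(\<lambda>s. half_mellin k ((s + of_nat k) / 2) a c) holomorphic_on UNIV"
    by (rule holomorphic_on_compose_gen[OF _ half_mellin_entire[of c k a], unfolded o_def])
       (use assms in \<open>auto intro!: holomorphic_intros\<close>)
  moreover have "(\<lambda>s. half_mellin k ((1 - s + of_nat k) / 2) (1 - c) a) holomorphic_on UNIV"
    by (rule holomorphic_on_compose_gen[OF _ half_mellin_entire[of a k "1 - c"], unfolded o_def])
       (use assms in \<open>auto intro!: holomorphic_intros\<close>)
  ultimately show ?thesis
    unfolding completed_Lerch_def by (intro holomorphic_intros)
qed

text \<open>Theta has weight k + 1/2, and k + 1/2 - (s + k)/2 = (1 - s + k)/2: this is where s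
  \<mapsto> 1 - s originates.\<close>

lemma theta_inversion:
  assumes a: "0 < a" "a < 1" and c: "0 < c" "c < 1" and k: "k \<le> 1"
  shows "theta k (exp (- u)) a c * exp ((s + of_nat k) / 2 * of_real (- u))
    = \<i> ^ k * exp (- (2 * pi * \<i> * a * c)) * (theta k (exp u) (1 - c) a * exp ((1 - s + of_nat k) / 2 * of_real u))"
proof -
  define q where "q = exp (- (2 * pi * \<i> * a * c)) * theta k (exp u) (1 - c) a"
  have tr: "q = (- \<i> / exp u) ^ k / sqrt (exp u) * theta k (exp (- u)) a c"
    unfolding q_def using theta_transformation[OF a _ _ exp_gt_zero[of u] k, of c] c
    by (simp add: exp_minus divide_inverse)
  have sq: "sqrt (exp u) = exp (u / 2)" by (rule real_sqrt_unique) (simp_all add: power2_eq_square flip: exp_add)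
  have "theta k (exp (- u)) a c = (\<i> * exp u) ^ k * exp (u / 2) * q"
  proof -
    have "(\<i> * exp u) ^ k * (- \<i> / exp u) ^ k = (1::complex)"
      by (simp flip: power_mult_distrib)
    then show ?thesis unfolding tr sq by simp
  qed
  also have "\<dots> * exp ((s + of_nat k) / 2 * of_real (- u)) =
      \<i> ^ k * q * (exp (of_nat k * of_real u) * exp (of_real (u / 2)) * exp ((s + of_nat k) / 2 * of_real (- u)))"
    by (simp only: power_mult_distrib exp_of_nat_mult exp_of_real of_real_mult mult_ac)
  also have "exp (of_nat k * of_real u) * exp (of_real (u / 2)) * exp ((s + of_nat k) / 2 * of_real (- u)) = exp ((1 - s + of_nat k) / 2 * of_real u)"
    unfolding exp_add[symmetric] by (rule arg_cong[where f = exp]) (simp add: field_simps)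
  finally show ?thesis by (simp add: q_def mult_ac)
qed

lemma lborel_integral_split_reflect:
  fixes F :: "real \<Rightarrow> complex"
  assumes F: "integrable lborel F"
  shows "integral\<^sup>L lborel F = (\<integral>u. indicator {0..} u *\<^sub>R F u \<partial>lborel) + (\<integral>u. indicator {0..} u *\<^sub>R F (- u) \<partial>lborel)"
proof -
  have [measurable]: "F \<in> borel_measurable borel" using F by (simp add: borel_measurable_integrable)
  have "integral\<^sup>L lborel F = (\<integral>u. indicator {0..} u *\<^sub>R F u + indicator {..<0} u *\<^sub>R F u \<partial>lborel)"
    by (intro Bochner_Integration.integral_cong) (auto simp: indicator_def)
  also have "\<dots> = (\<integral>u. indicator {0..} u *\<^sub>R F u \<partial>lborel) + (\<integral>u. indicator {..<0} u *\<^sub>R F u \<partial>lborel)"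
    by (intro Bochner_Integration.integral_add integrable_mult_indicator F) auto
  also have "(\<integral>u. indicator {..<0} u *\<^sub>R F u \<partial>lborel) = (\<integral>u. indicator {..<0} (0 + - 1 * u) *\<^sub>R F (0 + - 1 * u) \<partial>lborel)"
    by (subst lborel_integral_real_affine[of "-1" _ 0]) auto
  also have "\<dots> = (\<integral>u. indicator {0..} u *\<^sub>R F (- u) \<partial>lborel)"
    by (intro integral_cong_AE) (auto intro!: AE_I[where N = "{0}"] simp: indicator_def)
  finally show ?thesis .
qed

section \<open>Identification with the Lerch series for Re s > 1\<close>

definition Lerch_series :: "nat \<Rightarrow> complex \<Rightarrow> real \<Rightarrow> real \<Rightarrow> complex" where
  "Lerch_series k s a c = (\<Sum>\<^sub>\<infinity>n::int. of_real (sgn (of_int n + c) ^ k) * exp (2 * pi * \<i> * of_int n * a) *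
     complex_of_real \<bar>of_int n + c\<bar> powr (- s))"

definition Lerch_factor :: "nat \<Rightarrow> complex \<Rightarrow> complex" where
  "Lerch_factor k s = exp (- ((s + of_nat k) / 2 * of_real (ln pi))) * Gamma ((s + of_nat k) / 2)"

text \<open>The Gamma integral with d = pi x^2. Writing x^k = (sgn x)^k |x|^k, the modulus shifts
  the exponent from s + k back to s and the sign survives, so k = 0 leads to L^+ and k = 1 to
  L^-.\<close>

lemma gauss_mellin:
  fixes x :: real
  assumes s: "Re s + real k > 0" and x: "x \<noteq> 0"
  shows "has_bochner_integral lborel (\<lambda>u. of_real (x ^ k * exp (- (pi * exp u * x\<^sup>2))) * exp ((s + of_nat k) / 2 * of_real u))
     (Lerch_factor k s * of_real (sgn x ^ k) * of_real \<bar>x\<bar> powr (- s))"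
proof -
  define z where "z = (s + of_nat k) / 2"
  have "Re z > 0" using s by (simp add: z_def)
  then have hb: "has_bochner_integral lborel (\<lambda>u. of_real (x ^ k) * (of_real (exp (- (pi * x\<^sup>2 * exp u))) * exp (z * of_real u)))
     (of_real (x ^ k) * (exp (- (z * of_real (ln (pi * x\<^sup>2)))) * Gamma z))"
    using x by (intro has_bochner_integral_mult_right Gamma_log_integral) auto
  have E: "of_real (x ^ k) * exp (- (z * of_real (ln (pi * x\<^sup>2)))) = exp (- (z * of_real (ln pi))) * of_real (sgn x ^ k) * of_real \<bar>x\<bar> powr (- s)"
  proof -
    have ln: "ln (pi * x\<^sup>2) = ln pi + 2 * ln \<bar>x\<bar>"
    proof -
      have "ln (x\<^sup>2) = 2 * ln \<bar>x\<bar>" using x ln_realpow[of "\<bar>x\<bar>" 2] by simp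
      then show ?thesis using x by (simp add: ln_mult)
    qed
    have "x ^ k = sgn x ^ k * \<bar>x\<bar> ^ k" by (metis mult_sgn_abs power_mult_distrib)
    moreover have "complex_of_real (\<bar>x\<bar> ^ k) = exp (of_nat k * of_real (ln \<bar>x\<bar>))"
      using x by (simp add: exp_of_nat_mult exp_of_real)
    moreover have "complex_of_real \<bar>x\<bar> powr (- s) = exp (- s * of_real (ln \<bar>x\<bar>))"
      using x by (simp add: powr_def Ln_of_real)
    moreover have "exp (of_nat k * of_real (ln \<bar>x\<bar>)) * exp (- (z * of_real (ln (pi * x\<^sup>2)))) = exp (- (z * of_real (ln pi))) * exp (- s * of_real (ln \<bar>x\<bar>))"
      unfolding exp_add[symmetric] ln by (rule arg_cong[where f = exp]) (simp add: z_def field_simps)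
    ultimately show ?thesis by (simp add: mult_ac)
  qed
  have "of_real (x ^ k) * (exp (- (z * of_real (ln (pi * x\<^sup>2)))) * Gamma z) = Lerch_factor k s * of_real (sgn x ^ k) * of_real \<bar>x\<bar> powr (- s)"
    unfolding Lerch_factor_def z_def[symmetric] mult.assoc[symmetric] E by (simp add: mult_ac)
  moreover have "of_real (x ^ k) * (of_real (exp (- (pi * x\<^sup>2 * exp u))) * exp (z * of_real u))
      = of_real (x ^ k * exp (- (pi * exp u * x\<^sup>2))) * exp ((s + of_nat k) / 2 * of_real u)" for u
    by (simp add: z_def mult_ac)
  ultimately show ?thesis using hb by (simp only:)
qed

lemma theta_mellin:
  assumes c: "0 < c" "c < 1" and k: "k \<le> 1" and s: "Re s > 1"
  shows "integrable lborel (\<lambda>u. theta k (exp u) a c * exp ((s + of_nat k) / 2 * of_real u))"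
    and "(\<integral>u. theta k (exp u) a c * exp ((s + of_nat k) / 2 * of_real u) \<partial>lborel) = Lerch_factor k s * Lerch_series k s a c"
proof -
  define z where "z = (s + of_nat k) / 2"
  define f where "f = (\<lambda>n u. theta_term k (exp u) a c n * exp (z * of_real u))"
  have nz: "real_of_int n + c \<noteq> 0" for n
  proof
    assume "real_of_int n + c = 0"
    then have "- 1 < real_of_int n" "real_of_int n < 0" using c by linarith+
    then have "- 1 < n" "n < 0" by linarith+
    then show False by linarith
  qed
  have fe: "f n u = exp (2 * pi * \<i> * of_int n * a) * (of_real ((of_int n + c) ^ k * exp (- (pi * exp u * (of_int n + c)\<^sup>2))) * exp (z * of_real u))" for n u
    by (simp add: f_def theta_term_def)
  have hb: "has_bochner_integral lborel (f n) (exp (2 * pi * \<i> * of_int n * a) * (Lerch_factor k s * of_real (sgn (of_int n + c) ^ k) * of_real \<bar>of_int n + c\<bar> powr (- s)))" for n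
    unfolding fe z_def using gauss_mellin[OF _ nz] s by (intro has_bochner_integral_mult_right) auto
  then have f_int: "integrable lborel (f n)" for n by (auto simp: has_bochner_integral_iff)
  have s1: "(\<lambda>n. norm (f n u)) summable_on UNIV" for u
    unfolding f_def norm_mult using c k by (intro summable_on_cmult_left theta_term_abs_summable) auto
  \<comment> \<open>The L1 norms are computed exactly: the modulus of a term is the same kind of
    integrand with |n + c| in place of n + c and Re s in place of s. They are summable because Re s
    > 1.\<close>
  have nint: "(\<integral>u. norm (f n u) \<partial>lborel) = norm (Lerch_factor k (of_real (Re s))) * \<bar>of_int n + c\<bar> powr (- Re s)" for n
  proof -
    have "has_bochner_integral lborel (\<lambda>u. of_real (\<bar>of_int n + c\<bar> ^ k * exp (- (pi * exp u * \<bar>of_int n + c\<bar>\<^sup>2))) * exp ((of_real (Re s) + of_nat k) / 2 * of_real u))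
     (Lerch_factor k (of_real (Re s)) * of_real (sgn \<bar>of_int n + c\<bar> ^ k) * of_real \<bar>\<bar>of_int n + c\<bar>\<bar> powr (- of_real (Re s)))"
      using s nz[of n] by (intro gauss_mellin) auto
    moreover have "of_real (\<bar>of_int n + c\<bar> ^ k * exp (- (pi * exp u * \<bar>of_int n + c\<bar>\<^sup>2))) * exp ((of_real (Re s) + of_nat k) / 2 * of_real u) = complex_of_real (norm (f n u))" for u
    proof -
      have "complex_of_real (exp (Re z * u)) = exp ((of_real (Re s) + of_nat k) / 2 * of_real u)"
        by (simp add: z_def flip: exp_of_real)
      then show ?thesis
        unfolding f_def norm_mult norm_theta_term by (simp add: norm_exp_eq_Re)
    qed
    ultimately have "complex_of_real (\<integral>u. norm (f n u) \<partial>lborel) = (Lerch_factor k (of_real (Re s)) * of_real (sgn \<bar>of_int n + c\<bar> ^ k) * of_real \<bar>\<bar>of_int n + c\<bar>\<bar> powr (- of_real (Re s)))"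
      by (simp add: has_bochner_integral_iff)
    then have "norm (complex_of_real (\<integral>u. norm (f n u) \<partial>lborel)) = norm (Lerch_factor k (of_real (Re s)) * of_real (sgn \<bar>of_int n + c\<bar> ^ k) * of_real \<bar>\<bar>of_int n + c\<bar>\<bar> powr (- of_real (Re s)))"
      by (rule arg_cong)
    then show ?thesis using nz[of n]
      by (simp add: norm_mult norm_powr_real_powr sgn_if del: of_real_add)
  qed
  have s2: "(\<lambda>n. \<integral>u. norm (f n u) \<partial>lborel) summable_on UNIV"
    unfolding nint using s c by (intro summable_on_cmult_right summable_on_int_shift_powr) auto
  have th: "(\<Sum>\<^sub>\<infinity>n. f n u) = theta k (exp u) a c * exp (z * of_real u)" for u
    by (simp only: f_def theta_def infsum_cmult_left')
  note I = integral_infsum_int[OF f_int s1 s2, unfolded th]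
  show "integrable lborel (\<lambda>u. theta k (exp u) a c * exp ((s + of_nat k) / 2 * of_real u))"
    using I(1) by (simp add: z_def)
  have "integral\<^sup>L lborel (f n) = Lerch_factor k s * (of_real (sgn (of_int n + c) ^ k) * exp (2 * pi * \<i> * of_int n * a) *
     complex_of_real \<bar>of_int n + c\<bar> powr (- s))" for n
    using hb[of n] by (simp add: has_bochner_integral_iff mult_ac)
  then show "(\<integral>u. theta k (exp u) a c * exp ((s + of_nat k) / 2 * of_real u) \<partial>lborel) = Lerch_factor k s * Lerch_series k s a c"
    using I(2) by (simp only: z_def Lerch_series_def infsum_cmult_right')
qed

lemma completed_Lerch_eq_series:
  assumes a: "0 < a" "a < 1" and c: "0 < c" "c < 1" and k: "k \<le> 1" and s: "Re s > 1"
  shows "completed_Lerch k s a c = Lerch_factor k s * Lerch_series k s a c"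
proof -
  have "Lerch_factor k s * Lerch_series k s a c =
     (\<integral>u. indicator {0..} u *\<^sub>R (theta k (exp u) a c * exp ((s + of_nat k) / 2 * of_real u)) \<partial>lborel)
     + (\<integral>u. indicator {0..} u *\<^sub>R (theta k (exp (- u)) a c * exp ((s + of_nat k) / 2 * of_real (- u))) \<partial>lborel)"
    unfolding theta_mellin(2)[OF c k s, of a, symmetric] by (rule lborel_integral_split_reflect[OF theta_mellin(1)[OF c k s]])
  also have "(\<integral>u. indicator {0..} u *\<^sub>R (theta k (exp (- u)) a c * exp ((s + of_nat k) / 2 * of_real (- u))) \<partial>lborel)
     = (\<integral>u. \<i> ^ k * exp (- (2 * pi * \<i> * a * c)) * (indicator {0..} u *\<^sub>R (theta k (exp u) (1 - c) a * exp ((1 - s + of_nat k) / 2 * of_real u))) \<partial>lborel)"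
    unfolding theta_inversion[OF a c k] by (simp add: mult_ac)
  also have "\<dots> = \<i> ^ k * exp (- (2 * pi * \<i> * a * c)) * half_mellin k ((1 - s + of_nat k) / 2) (1 - c) a"
    unfolding half_mellin_def by (rule integral_mult_right_zero)
  finally show ?thesis by (simp add: completed_Lerch_def half_mellin_def)
qed

text \<open>The reciprocal of \<open>Lerch_factor\<close>, but entire: at the poles of Gamma it vanishes.\<close>

definition Lerch_cofactor :: "nat \<Rightarrow> complex \<Rightarrow> complex" where
  "Lerch_cofactor k s = exp ((s + of_nat k) / 2 * of_real (ln pi)) * rGamma ((s + of_nat k) / 2)"

lemma Lerch_cofactor_mult_factor:
  assumes "Re s + real k > 0"
  shows "Lerch_cofactor k s * Lerch_factor k s = 1"
proof -
  define z where "z = (s + of_nat k) / 2"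
  have "Re z > 0" using assms by (simp add: z_def)
  then have "z \<notin> \<int>\<^sub>\<le>\<^sub>0" by (auto elim!: nonpos_Ints_cases)
  then have "rGamma z * Gamma z = 1"
    by (simp add: rGamma_inverse_Gamma Gamma_eq_zero_iff)
  then show ?thesis
    unfolding Lerch_cofactor_def Lerch_factor_def z_def[symmetric] by (simp add: exp_minus field_simps)
qed

lemma entire_continuation_Lerch_series:
  assumes a: "0 < a" "a < 1" and c: "0 < c" "c < 1" and k: "k \<le> 1"
  shows "entire_continuation (\<lambda>s. Lerch_series k s a c) s = Lerch_cofactor k s * completed_Lerch k s a c"
proof -
  have "entire_continuation (\<lambda>s. Lerch_series k s a c) = (\<lambda>s. Lerch_cofactor k s * completed_Lerch k s a c)"
  proof (rule entire_continuation_eqI)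
    show "(\<lambda>s. Lerch_cofactor k s * completed_Lerch k s a c) holomorphic_on UNIV"
      unfolding Lerch_cofactor_def
      by (intro holomorphic_intros completed_Lerch_entire assms holomorphic_on_compose_gen[OF _ holomorphic_rGamma, unfolded o_def]) auto
    fix s :: complex assume "Re s > 1"
    then show "Lerch_cofactor k s * completed_Lerch k s a c = Lerch_series k s a c"
      using completed_Lerch_eq_series[OF assms] Lerch_cofactor_mult_factor[of s k]
      by (simp flip: mult.assoc)
  qed
  then show ?thesis by simp
qed

lemma Lerch_plus_eq:
  assumes "0 < a" "a < 1" "0 < c" "c < 1"
  shows "Lerch_plus s a c = Lerch_cofactor 0 s * completed_Lerch 0 s a c"
  using entire_continuation_Lerch_series[OF assms, of 0 s]
  by (simp add: Lerch_plus_def Lerch_plus_series_def Lerch_series_def)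

lemma Lerch_minus_eq:
  assumes "0 < a" "a < 1" "0 < c" "c < 1"
  shows "Lerch_minus s a c = Lerch_cofactor 1 s * completed_Lerch 1 s a c"
  using entire_continuation_Lerch_series[OF assms, of 1 s]
  by (simp add: Lerch_minus_def Lerch_minus_series_def Lerch_series_def)

section \<open>Boundary behaviour\<close>

text \<open>The integral over the whole line is exact by \<open>gauss_mellin\<close>. The discarded
  half u < 0 is bounded uniformly in x: there x^k and the Gaussian are at most 1, and exp (Re z u)
  is integrable since Re z > 0.\<close>

lemma gauss_half_mellin_asymp:
  fixes x :: real
  assumes s: "Re s > 0" and x: "0 < x" "x < 1"
  shows "norm ((\<integral>u. indicator {0..} u *\<^sub>R (of_real (x ^ k * exp (- (pi * exp u * x\<^sup>2))) * exp ((s + of_nat k) / 2 * of_real u)) \<partial>lborel)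
      - Lerch_factor k s * of_real x powr (- s)) \<le> exp 1 * Gamma ((Re s + k) / 2)"
proof -
  define z where "z = (s + of_nat k) / 2"
  have z: "Re z = (Re s + k) / 2" "Re z > 0" using s by (simp_all add: z_def)
  define F where "F = (\<lambda>u. of_real (x ^ k * exp (- (pi * exp u * x\<^sup>2))) * exp (z * of_real u))"
  have hb: "has_bochner_integral lborel F (Lerch_factor k s * of_real x powr (- s))"
    unfolding F_def z_def using gauss_mellin[of s k x] s x by simp
  then have F: "integrable lborel F" "integral\<^sup>L lborel F = Lerch_factor k s * of_real x powr (- s)"
    by (simp_all add: has_bochner_integral_iff)
  have "integral\<^sup>L lborel F = (\<integral>u. indicator {0..} u *\<^sub>R F u + indicator {..<0} u *\<^sub>R F u \<partial>lborel)"
    by (intro Bochner_Integration.integral_cong) (auto simp: indicator_def)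
  also have "\<dots> = (\<integral>u. indicator {0..} u *\<^sub>R F u \<partial>lborel) + (\<integral>u. indicator {..<0} u *\<^sub>R F u \<partial>lborel)"
    by (intro Bochner_Integration.integral_add integrable_mult_indicator F) auto
  finally have "(\<integral>u. indicator {0..} u *\<^sub>R F u \<partial>lborel) - Lerch_factor k s * of_real x powr (- s) = - (\<integral>u. indicator {..<0} u *\<^sub>R F u \<partial>lborel)"
    unfolding F(2) by simp
  then have "norm ((\<integral>u. indicator {0..} u *\<^sub>R F u \<partial>lborel) - Lerch_factor k s * of_real x powr (- s)) = norm (\<integral>u. indicator {..<0} u *\<^sub>R F u \<partial>lborel)"
    by simp
  also have "\<dots> \<le> (\<integral>u. norm (indicator {..<0} u *\<^sub>R F u) \<partial>lborel)"
    by (rule integral_norm_bound)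
  also have "\<dots> \<le> (\<integral>u. exp 1 * (exp (- (1 * exp u)) * exp (Re z * u)) \<partial>lborel)"
  proof (intro Bochner_Integration.integral_mono integrable_norm integrable_mult_indicator F)
    show "integrable lborel (\<lambda>u. exp 1 * (exp (- (1 * exp u)) * exp (Re z * u)))"
      using Gamma_log_integral_real[OF z(2), of 1] by (intro integrable_mult_right) (simp add: has_bochner_integral_iff)
    fix u :: real
    show "norm (indicator {..<0} u *\<^sub>R F u) \<le> exp 1 * (exp (- (1 * exp u)) * exp (Re z * u))"
    proof (cases "u < 0")
      case True
      have "norm (F u) = x ^ k * exp (- (pi * exp u * x\<^sup>2)) * exp (Re z * u)"
        using x by (simp add: F_def norm_mult norm_power norm_exp_eq_Re)
      also have "\<dots> \<le> 1 * 1 * exp (Re z * u)"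
        using x by (intro mult_mono power_le_one) auto
      \<comment> \<open>For u < 0 the inserted factor is at least 1. It makes the half-line integral
        comparable with the Gamma integral, whence the constant \<open>exp 1\<close>.\<close>
      also have "\<dots> \<le> exp (1 - exp u) * exp (Re z * u)"
        using True by (intro mult_right_mono) auto
      also have "\<dots> = exp 1 * (exp (- (1 * exp u)) * exp (Re z * u))"
        by (simp add: exp_diff exp_minus divide_inverse)
      finally show ?thesis using True by simp
    qed simp
  qed auto
  also have "\<dots> = exp 1 * (\<integral>u. exp (- (1 * exp u)) * exp (Re z * u) \<partial>lborel)"
    by (rule integral_mult_right_zero)
  also have "(\<integral>u. exp (- (1 * exp u)) * exp (Re z * u) \<partial>lborel) = Gamma (Re z)"
    using Gamma_log_integral_real[OF z(2), of 1] by (simp add: has_bochner_integral_iff)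
  finally show ?thesis unfolding F_def z by (simp add: z_def)
qed

text \<open>The terms n = 0 and n = -1 contribute the two powers, each up to a bounded error; the
  remaining terms contribute at most \<open>theta_far\<close> times a Gamma value. The error is
  uniform in a and c, so the estimate serves both the slices and the bound on the whole
  square.\<close>

lemma half_mellin_asymp:
  assumes s: "Re s > 0" and k: "k \<le> 1" and c: "0 < c" "c < 1"
  shows "norm (half_mellin k ((s + of_nat k) / 2) a c
      - Lerch_factor k s * (of_real c powr (- s) + (- 1) ^ k * exp (- (2 * pi * \<i> * a)) * of_real (1 - c) powr (- s)))
    \<le> (2 * exp 1 + theta_far) * Gamma ((Re s + k) / 2)"
proof -
  define z where "z = (s + of_nat k) / 2"
  have z: "Re z = (Re s + k) / 2" "Re z > 0" using s by (simp_all add: z_def)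
  \<comment> \<open>What the term n = -1 carries: n + c = - (1 - c) gives the sign, and the
    character at n = -1 gives the exponential.\<close>
  define W where "W = (- 1) ^ k * exp (- (2 * pi * \<i> * a))"
  have nW: "norm W = 1" by (simp add: W_def norm_mult norm_power norm_exp_eq_Re)
  define G where "G = (\<lambda>x u. indicator {0..} u *\<^sub>R (complex_of_real (x ^ k * exp (- (pi * exp u * x\<^sup>2))) * exp (z * of_real u)))"
  define T where "T = (\<lambda>u. indicator {0..} u *\<^sub>R (theta k (exp u) a c * exp (z * of_real u)))"
  have G_int: "integrable lborel (G x)" if "0 < x" "x < 1" for x
    unfolding G_def z_def using gauss_mellin[of s k x] s that
    by (intro integrable_mult_indicator) (auto simp: has_bochner_integral_iff)
  have T_int: "integrable lborel T"
    unfolding T_def by (intro half_mellin_integrable c k)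
  have c': "0 < 1 - c" "1 - c < 1" using c by auto
  define R where "R = (\<lambda>u. T u - (G c u + W * G (1 - c) u))"
  have R_int: "integrable lborel R"
    unfolding R_def by (intro Bochner_Integration.integrable_diff Bochner_Integration.integrable_add integrable_mult_right T_int G_int c c')
  have "integral\<^sup>L lborel R = integral\<^sup>L lborel T - (integral\<^sup>L lborel (G c) + W * integral\<^sup>L lborel (G (1 - c)))"
    unfolding R_def using T_int G_int[OF c] G_int[OF c'] by simp
  moreover have "norm (integral\<^sup>L lborel R) \<le> theta_far * Gamma (Re z)"
  proof -
    have "norm (integral\<^sup>L lborel R) \<le> (\<integral>u. norm (R u) \<partial>lborel)" by (rule integral_norm_bound)
    also have "\<dots> \<le> (\<integral>u. theta_far * (exp (- (1 * exp u)) * exp (Re z * u)) \<partial>lborel)"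
    proof (intro Bochner_Integration.integral_mono integrable_norm R_int)
      show "integrable lborel (\<lambda>u. theta_far * (exp (- (1 * exp u)) * exp (Re z * u)))"
        using Gamma_log_integral_real[OF z(2), of 1] by (intro integrable_mult_right) (simp add: has_bochner_integral_iff)
      fix u :: real
      show "norm (R u) \<le> theta_far * (exp (- (1 * exp u)) * exp (Re z * u))"
      proof (cases "u \<ge> 0")
        case True
        have t0: "theta_term k (exp u) a c 0 = of_real (c ^ k * exp (- (pi * exp u * c\<^sup>2)))"
          by (simp add: theta_term_def)
        have x: "real_of_int (- 1) + c = - (1 - c)" by simp
        have "exp (2 * pi * \<i> * of_int (- 1) * a) = exp (- (2 * pi * \<i> * a))" by simp
        then have t1: "theta_term k (exp u) a c (- 1) = W * of_real ((1 - c) ^ k * exp (- (pi * exp u * (1 - c)\<^sup>2)))"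
          unfolding theta_term_def x power2_minus W_def by (subst power_minus) (simp add: mult_ac)
        have "R u = (theta k (exp u) a c - (theta_term k (exp u) a c 0 + theta_term k (exp u) a c (- 1))) * exp (z * of_real u)"
          unfolding R_def T_def G_def t0 t1 using True by (simp add: algebra_simps)
        then have "norm (R u) \<le> (theta_far * exp (- exp u)) * exp (Re z * u)"
          using norm_theta_minus_near_le[of c "exp u" k a] c k True
          by (auto simp: norm_mult norm_exp_eq_Re intro!: mult_right_mono)
        then show ?thesis by (simp add: mult.assoc)
      next
        case False
        then show ?thesis using theta_far_nonneg by (simp add: R_def T_def G_def)
      qed
    qed
    also have "\<dots> = theta_far * (\<integral>u. exp (- (1 * exp u)) * exp (Re z * u) \<partial>lborel)"
      by (rule integral_mult_right_zero)
    also have "(\<integral>u. exp (- (1 * exp u)) * exp (Re z * u) \<partial>lborel) = Gamma (Re z)"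
      using Gamma_log_integral_real[OF z(2), of 1] by (simp add: has_bochner_integral_iff)
    finally show ?thesis .
  qed
  moreover have "norm (integral\<^sup>L lborel (G c) - Lerch_factor k s * of_real c powr (- s)) \<le> exp 1 * Gamma (Re z)"
    using gauss_half_mellin_asymp[OF s c, of k] by (simp add: G_def z_def)
  moreover have "norm (W * (integral\<^sup>L lborel (G (1 - c)) - Lerch_factor k s * of_real (1 - c) powr (- s))) \<le> exp 1 * Gamma (Re z)"
    using gauss_half_mellin_asymp[OF s c', of k] unfolding norm_mult nW by (simp add: G_def z_def)
  moreover have "half_mellin k z a c = integral\<^sup>L lborel T" by (simp add: half_mellin_def T_def)
  then have "half_mellin k z a c - Lerch_factor k s * (of_real c powr (- s) + W * of_real (1 - c) powr (- s))
    = (integral\<^sup>L lborel T - (integral\<^sup>L lborel (G c) + W * integral\<^sup>L lborel (G (1 - c))))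
      + ((integral\<^sup>L lborel (G c) - Lerch_factor k s * of_real c powr (- s))
      + W * (integral\<^sup>L lborel (G (1 - c)) - Lerch_factor k s * of_real (1 - c) powr (- s)))"
    by (simp add: algebra_simps)
  ultimately have "norm (half_mellin k z a c - Lerch_factor k s * (of_real c powr (- s) + W * of_real (1 - c) powr (- s)))
    \<le> theta_far * Gamma (Re z) + (exp 1 * Gamma (Re z) + exp 1 * Gamma (Re z))"
    by (simp only:) (intro order.trans[OF norm_triangle_ineq] add_mono; simp)
  then show ?thesis unfolding z_def W_def z(1)[unfolded z_def] by (simp add: algebra_simps)
qed

text \<open>For fixed a the dual half is bounded in c, so the singularities at both ends of the
  slice come from the first half alone. The constant may blow up as a approaches 0 or 1.\<close>

lemma completed_Lerch_asymp:
  assumes s: "Re s > 0" and k: "k \<le> 1" and a: "0 < a" "a < 1"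
  obtains C where "\<And>c. 0 < c \<Longrightarrow> c < 1 \<Longrightarrow>
    norm (completed_Lerch k s a c
      - Lerch_factor k s * (of_real c powr (- s) + (- 1) ^ k * exp (- (2 * pi * \<i> * a)) * of_real (1 - c) powr (- s))) \<le> C"
proof
  fix c :: real assume c: "0 < c" "c < 1"
  let ?X = "Lerch_factor k s * (of_real c powr (- s) + (- 1) ^ k * exp (- (2 * pi * \<i> * a)) * of_real (1 - c) powr (- s))"
  let ?z = "(1 - s + of_nat k) / 2"
  have "completed_Lerch k s a c - ?X = (half_mellin k ((s + of_nat k) / 2) a c - ?X) + \<i> ^ k * exp (- (2 * pi * \<i> * a * c)) * half_mellin k ?z (1 - c) a"
    by (simp add: completed_Lerch_def)
  also have "norm \<dots> \<le> norm (half_mellin k ((s + of_nat k) / 2) a c - ?X) + norm (\<i> ^ k * exp (- (2 * pi * \<i> * a * c)) * half_mellin k ?z (1 - c) a)"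
    by (rule norm_triangle_ineq)
  also have "\<dots> \<le> (2 * exp 1 + theta_far) * Gamma ((Re s + k) / 2) + (\<integral>u. indicator {0..} u * (theta_bound a u * exp (Re ?z * u)) \<partial>lborel)"
    using half_mellin_asymp[OF s k c, of a] norm_half_mellin_le[OF a k, of ?z "1 - c"]
    by (intro add_mono) (simp_all add: norm_mult norm_power)
  finally show "norm (completed_Lerch k s a c - ?X) \<le> (2 * exp 1 + theta_far) * Gamma ((Re s + k) / 2) + (\<integral>u. indicator {0..} u * (theta_bound a u * exp (Re ?z * u)) \<partial>lborel)" .
qed

section \<open>Divergence along slices\<close>

lemma not_integrable_powr_at_0:
  fixes b q :: real
  assumes b: "0 < b" "b \<le> 1" and q: "q \<ge> 1"
  shows "\<not> integrable lborel (\<lambda>x. indicator {0<..<b} x * x powr (- q))"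
proof
  assume int: "integrable lborel (\<lambda>x. indicator {0<..<b} x * x powr (- q))"
  define I where "I = (\<integral>x. indicator {0<..<b} x * x powr (- q) \<partial>lborel)"
  \<comment> \<open>Chosen so that the integral of 1/x from e to b/2 is |I| + 1, which exceeds the
    supposed value I.\<close>
  define e where "e = b / 2 * exp (- (\<bar>I\<bar> + 1))"
  have e: "0 < e" "e \<le> b / 2" using b by (simp_all add: e_def mult_le_cancel_left1)
  have hb: "has_bochner_integral lborel (\<lambda>x. (1 / x) * indicator {e..b/2} x) (ln (b / 2) - ln e)"
    using e by (intro has_bochner_integral_FTC_Icc_real) (auto intro!: derivative_eq_intros continuous_intros)
  have "ln (b / 2) - ln e \<le> I"
    unfolding I_def has_bochner_integral_integral_eq[OF hb, symmetric]
  proof (intro Bochner_Integration.integral_mono int)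
    show "integrable lborel (\<lambda>x. (1 / x) * indicator {e..b/2} x)" using hb by (simp add: has_bochner_integral_iff)
    fix x :: real
    show "1 / x * indicator {e..b/2} x \<le> indicator {0<..<b} x * x powr (- q)"
    proof (cases "x \<in> {e..b/2}")
      case True
      then have x: "0 < x" "x < b" "x \<le> 1" using e b by auto
      have "x powr (- 1) \<le> x powr (- q)" using x q by (intro powr_mono') auto
      moreover have "x powr (- 1) = 1 / x" using x(1) by (simp add: powr_minus_divide)
      moreover have "indicator {e..b/2} x = (1::real)" "indicator {0<..<b} x = (1::real)"
        using True x by auto
      ultimately show ?thesis by (simp only: mult_1 mult_1_right)
    next
      case False
      then show ?thesis by simp
    qed
  qed
  moreover have "ln e = ln (b / 2) - (\<bar>I\<bar> + 1)"
    unfolding e_def using b by (subst ln_mult) auto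
  ultimately show False by linarith
qed

lemma add_powr_le:
  fixes x y p :: real
  assumes "0 \<le> x" "0 \<le> y" "0 \<le> p"
  shows "(x + y) powr p \<le> 2 powr p * (x powr p + y powr p)"
proof -
  have "(x + y) powr p \<le> (2 * max x y) powr p"
    using assms by (intro powr_mono2) auto
  also have "\<dots> = 2 powr p * max x y powr p" using assms by (simp add: powr_mult)
  also have "\<dots> \<le> 2 powr p * (x powr p + y powr p)"
    by (intro mult_left_mono) (auto simp: max_def)
  finally show ?thesis .
qed

text \<open>The asymptotics bound |\<kappa>| x^(-Re s) by |f x| + B, so p-integrability of f would
  pass to x^(-Re s) on a bounded interval, where p Re s \<ge> 1 forbids it.\<close>

lemma not_integrable_norm_powr_of_asymp:
  fixes f :: "real \<Rightarrow> complex"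
  assumes b: "0 < b" "b \<le> 1" and \<kappa>: "\<kappa> \<noteq> 0" and p: "p \<ge> 1" "Re s \<ge> 1 / p"
    and B: "\<And>x. 0 < x \<Longrightarrow> x < b \<Longrightarrow> norm (f x - \<kappa> * of_real x powr (- s)) \<le> B"
  shows "\<not> integrable lborel (\<lambda>x. indicator {0<..<b} x * norm (f x) powr p)"
proof
  assume int: "integrable lborel (\<lambda>x. indicator {0<..<b} x * norm (f x) powr p)"
  have B0: "B \<ge> 0" using order.trans[OF norm_ge_zero B[of "b/2"]] b by simp
  define g where "g = (\<lambda>x. (2 powr p / norm \<kappa> powr p) * (indicator {0<..<b} x * norm (f x) powr p + indicator {0<..<b} x * B powr p))"
  have "integrable lborel (\<lambda>x. indicator {0<..<b} x * x powr (- (Re s * p)))"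
  proof (rule Bochner_Integration.integrable_bound)
    have "integrable lborel (\<lambda>x. indicator {0<..<b} x * B powr p)"
      using b by (intro integrable_real_mult_indicator integrable_mult_left) auto
    then show "integrable lborel g"
      unfolding g_def by (intro integrable_mult_right Bochner_Integration.integrable_add int)
    show "AE x in lborel. norm (indicator {0<..<b} x * x powr (- (Re s * p))) \<le> norm (g x)"
    proof (intro AE_I2)
      fix x :: real
      show "norm (indicator {0<..<b} x * x powr (- (Re s * p))) \<le> norm (g x)"
      proof (cases "x \<in> {0<..<b}")
        case True
        then have x: "0 < x" "x < b" by auto
        have "norm \<kappa> * x powr (- Re s) = norm (\<kappa> * of_real x powr (- s))"
          using x by (simp add: norm_mult norm_powr_real_powr)
        also have "\<dots> \<le> norm (f x) + B"
          using norm_triangle_sub[of "\<kappa> * of_real x powr (- s)" "f x"] B[OF x] by (simp add: norm_minus_commute)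
        finally have "(norm \<kappa> * x powr (- Re s)) powr p \<le> (norm (f x) + B) powr p"
          using p by (intro powr_mono2) auto
        also have "\<dots> \<le> 2 powr p * (norm (f x) powr p + B powr p)"
          using B0 p by (intro add_powr_le) auto
        also have "(norm \<kappa> * x powr (- Re s)) powr p = norm \<kappa> powr p * x powr (- (Re s * p))"
          by (simp add: powr_mult powr_powr)
        finally have "x powr (- (Re s * p)) \<le> g x"
          using \<kappa> True by (simp add: g_def field_simps)
        then show ?thesis using True by simp
      qed simp
    qed
  qed auto
  moreover have "Re s * p \<ge> 1" using p by (simp add: field_simps)
  ultimately show False using not_integrable_powr_at_0[OF b] by blast
qed

lemma Lerch_factor_nonzero: "Re s > 0 \<Longrightarrow> Lerch_factor k s \<noteq> 0"
  using Lerch_cofactor_mult_factor[of s k] by auto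

text \<open>The coefficients at c = 0 and c = 1 are \<kappa>1 and \<kappa>2. As functions of
  \<alpha> and \<beta> they form an invertible linear map because the Gamma factors are nonzero for
  Re s > 0, so the slice diverges at one end at least.\<close>

lemma completed_Lerch_slice_not_integrable:
  assumes p: "p \<ge> 1" "Re s \<ge> 1 / p" and a: "0 < a" "a < 1" and nz: "\<alpha> \<noteq> 0 \<or> \<beta> \<noteq> 0"
  shows "\<not> integrable lborel (\<lambda>c. indicator {0<..<1} c * norm (\<alpha> * completed_Lerch 0 s a c + \<beta> * completed_Lerch 1 s a c) powr p)"
proof
  define f where "f = (\<lambda>c. \<alpha> * completed_Lerch 0 s a c + \<beta> * completed_Lerch 1 s a c)"
  assume "integrable lborel (\<lambda>c. indicator {0<..<1} c * norm (\<alpha> * completed_Lerch 0 s a c + \<beta> * completed_Lerch 1 s a c) powr p)"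
  then have int: "integrable lborel (\<lambda>c. indicator {0<..<1} c * norm (f c) powr p)" by (simp add: f_def)
  have s: "Re s > 0" using p by (smt (verit) divide_pos_pos)
  define E where "E = exp (- (2 * pi * \<i> * a))"
  have nE: "norm E = 1" by (simp add: E_def norm_exp_eq_Re)
  define \<kappa>1 where "\<kappa>1 = \<alpha> * Lerch_factor 0 s + \<beta> * Lerch_factor 1 s"
  define \<kappa>2 where "\<kappa>2 = (\<alpha> * Lerch_factor 0 s - \<beta> * Lerch_factor 1 s) * E"
  obtain C0 where C0: "\<And>c. 0 < c \<Longrightarrow> c < 1 \<Longrightarrow>
    norm (completed_Lerch 0 s a c - Lerch_factor 0 s * (of_real c powr (- s) + (- 1) ^ 0 * exp (- (2 * pi * \<i> * a)) * of_real (1 - c) powr (- s))) \<le> C0"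
    using completed_Lerch_asymp[OF s _ a, of 0] by auto
  obtain C1 where C1: "\<And>c. 0 < c \<Longrightarrow> c < 1 \<Longrightarrow>
    norm (completed_Lerch 1 s a c - Lerch_factor 1 s * (of_real c powr (- s) + (- 1) ^ 1 * exp (- (2 * pi * \<i> * a)) * of_real (1 - c) powr (- s))) \<le> C1"
    using completed_Lerch_asymp[OF s _ a, of 1] by auto
  define C where "C = norm \<alpha> * C0 + norm \<beta> * C1"
  have C: "norm (f c - (\<kappa>1 * of_real c powr (- s) + \<kappa>2 * of_real (1 - c) powr (- s))) \<le> C" if c: "0 < c" "c < 1" for c
  proof -
    have "f c - (\<kappa>1 * of_real c powr (- s) + \<kappa>2 * of_real (1 - c) powr (- s)) =
       \<alpha> * (completed_Lerch 0 s a c - Lerch_factor 0 s * (of_real c powr (- s) + (- 1) ^ 0 * exp (- (2 * pi * \<i> * a)) * of_real (1 - c) powr (- s)))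
     + \<beta> * (completed_Lerch 1 s a c - Lerch_factor 1 s * (of_real c powr (- s) + (- 1) ^ 1 * exp (- (2 * pi * \<i> * a)) * of_real (1 - c) powr (- s)))"
      unfolding f_def \<kappa>1_def \<kappa>2_def E_def[symmetric] by (simp add: algebra_simps)
    also have "norm \<dots> \<le> norm \<alpha> * C0 + norm \<beta> * C1"
      unfolding norm_mult[symmetric]
      by (intro order.trans[OF norm_triangle_ineq] add_mono) (use C0[OF c] C1[OF c] in \<open>auto simp: norm_mult intro!: mult_left_mono\<close>)
    finally show ?thesis by (simp add: C_def)
  qed
  \<comment> \<open>On the half of the slice next to one end, the power attached to the other end is
    bounded and can be moved into the error.\<close>
  have far: "norm (\<kappa> * of_real (1 - c) powr (- s)) \<le> norm \<kappa> * 2 powr Re s" if "0 < c" "c < 1/2" for c \<kappa>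
  proof -
    have "(1 - c) powr (- Re s) \<le> (1/2) powr (- Re s)" using that s by (intro powr_mono2') auto
    also have "\<dots> = 2 powr Re s" by (simp add: powr_minus powr_divide)
    finally show ?thesis using that by (auto simp: norm_mult norm_powr_real_powr simp del: of_real_diff intro!: mult_left_mono)
  qed
  have half: "integrable lborel (\<lambda>c. indicator {0<..<1/2} c * norm (g c) powr p)"
    if "integrable lborel (\<lambda>c. indicator {0<..<1} c * norm (g c) powr p)" for g :: "real \<Rightarrow> complex"
  proof -
    have "integrable lborel (\<lambda>c. indicator {0<..<1/2} c *\<^sub>R (indicator {0<..<1} c * norm (g c) powr p))"
      by (intro integrable_mult_indicator that) auto
    moreover have "indicator {0<..<1/2} c *\<^sub>R (indicator {0<..<1} c * norm (g c) powr p) = indicator {0<..<1/2} c * norm (g c) powr p" for c :: real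
      by (auto simp: indicator_def)
    ultimately show ?thesis by (simp only:)
  qed
  show False
  proof (cases "\<kappa>1 = 0")
    case False
    have "norm (f c - \<kappa>1 * of_real c powr (- s)) \<le> C + norm \<kappa>2 * 2 powr Re s" if c: "0 < c" "c < 1/2" for c
    proof -
      have "f c - \<kappa>1 * of_real c powr (- s) = (f c - (\<kappa>1 * of_real c powr (- s) + \<kappa>2 * of_real (1 - c) powr (- s))) + \<kappa>2 * of_real (1 - c) powr (- s)"
        by simp
      also have "norm \<dots> \<le> C + norm \<kappa>2 * 2 powr Re s"
        using c by (intro order.trans[OF norm_triangle_ineq] add_mono C far) auto
      finally show ?thesis .
    qed
    from not_integrable_norm_powr_of_asymp[OF _ _ False p this] half[OF int] show False by simp
  next
    case True
    \<comment> \<open>With no singularity at c = 0 the other end must be singular; reflecting c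
      \<mapsto> 1 - c moves it to 0.\<close>
    have \<kappa>2: "\<kappa>2 \<noteq> 0"
    proof
      assume "\<kappa>2 = 0"
      then have "\<alpha> * Lerch_factor 0 s - \<beta> * Lerch_factor 1 s = 0" using nE by (auto simp: \<kappa>2_def)
      with True have "2 * (\<alpha> * Lerch_factor 0 s) = 0" "2 * (\<beta> * Lerch_factor 1 s) = 0"
        by (auto simp: \<kappa>1_def algebra_simps)
      then show False using nz Lerch_factor_nonzero[OF s] by auto
    qed
    have "norm (f (1 - c) - \<kappa>2 * of_real c powr (- s)) \<le> C + norm \<kappa>1 * 2 powr Re s" if c: "0 < c" "c < 1/2" for c
      using C[of "1 - c"] c True by simp
    moreover have "integrable lborel (\<lambda>c. indicator {0<..<1} (1 + - 1 * c) * norm (f (1 + - 1 * c)) powr p)"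
      by (rule lborel_integrable_real_affine[OF int]) simp
    then have "integrable lborel (\<lambda>c. indicator {0<..<1} c * norm (f (1 - c)) powr p)"
      by (rule Bochner_Integration.integrable_cong[OF refl, THEN iffD1, rotated]) (auto simp: indicator_def)
    ultimately show False
      using not_integrable_norm_powr_of_asymp[OF _ _ \<kappa>2 p, of "1/2" "\<lambda>c. f (1 - c)" "C + norm \<kappa>1 * 2 powr Re s"] half by auto
  qed
qed

section \<open>Measurability and integrability on the unit square\<close>

text \<open>The integrand is jointly measurable in the parameters and u, hence its integral over u
  is measurable in the parameters.\<close>

lemma half_mellin_measurable:
  fixes \<alpha> \<gamma> :: "'a \<Rightarrow> real"
  assumes [measurable]: "\<alpha> \<in> borel_measurable M" "\<gamma> \<in> borel_measurable M" and k: "k \<le> 1"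
  shows "(\<lambda>x. indicator {0..1} (\<gamma> x) *\<^sub>R half_mellin k z (\<alpha> x) (\<gamma> x)) \<in> borel_measurable M"
proof -
  have [measurable]: "(\<lambda>y. indicator {0..1} (\<gamma> (fst y)) *\<^sub>R theta k (exp (snd y)) (\<alpha> (fst y)) (\<gamma> (fst y))) \<in> borel_measurable (M \<Otimes>\<^sub>M lborel)"
    by (rule theta_measurable) (use k in auto)
  have "(\<lambda>x. \<integral>u. indicator {0..} u *\<^sub>R ((indicator {0..1} (\<gamma> (fst (x, u))) *\<^sub>R theta k (exp (snd (x, u))) (\<alpha> (fst (x, u))) (\<gamma> (fst (x, u)))) * exp (z * of_real u)) \<partial>lborel) \<in> borel_measurable M"
    by measurable
  moreover have "(\<integral>u. indicator {0..} u *\<^sub>R ((indicator {0..1} (\<gamma> (fst (x, u))) *\<^sub>R theta k (exp (snd (x, u))) (\<alpha> (fst (x, u))) (\<gamma> (fst (x, u)))) * exp (z * of_real u)) \<partial>lborel)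
     = indicator {0..1} (\<gamma> x) *\<^sub>R half_mellin k z (\<alpha> x) (\<gamma> x)" for x
    by (cases "\<gamma> x \<in> {0..1}") (simp_all add: half_mellin_def)
  ultimately show ?thesis by simp
qed

lemma on_open_square_eq_indicator:
  "on_open_square g x = indicator ({0<..<1} \<times> {0<..<1}) x *\<^sub>R g (fst x) (snd x)"
  by (auto simp: on_open_square_def indicator_def split: prod.splits)

lemma on_open_square_completed_Lerch_measurable:
  assumes k: "k \<le> 1"
  shows "on_open_square (completed_Lerch k s) \<in> borel_measurable borel"
proof -
  have [measurable]: "(\<lambda>x. indicator {0..1} (snd x) *\<^sub>R half_mellin k ((s + of_nat k) / 2) (fst x) (snd x)) \<in> borel_measurable (borel \<Otimes>\<^sub>M borel)"
    by (rule half_mellin_measurable) (use k in auto)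
  have [measurable]: "(\<lambda>x. indicator {0..1} (fst x) *\<^sub>R half_mellin k ((1 - s + of_nat k) / 2) (1 - snd x) (fst x)) \<in> borel_measurable (borel \<Otimes>\<^sub>M borel)"
    by (rule half_mellin_measurable) (use k in auto)
  define g where "g = (\<lambda>x. indicator ({0<..<1} \<times> {0<..<1}) x *\<^sub>R
      (indicator {0..1} (snd x) *\<^sub>R half_mellin k ((s + of_nat k) / 2) (fst x) (snd x) +
       \<i> ^ k * exp (- (2 * of_real pi * \<i> * of_real (fst x) * of_real (snd x))) *
         (indicator {0..1} (fst x) *\<^sub>R half_mellin k ((1 - s + of_nat k) / 2) (1 - snd x) (fst x))))"
  have "g \<in> borel_measurable (borel \<Otimes>\<^sub>M borel)"
    unfolding g_def by (intro borel_measurable_scaleR borel_measurable_indicator pair_measureI; measurable)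
  moreover have "g = on_open_square (completed_Lerch k s)"
    by (auto simp: g_def fun_eq_iff on_open_square_eq_indicator completed_Lerch_def indicator_def)
  ultimately show ?thesis by (simp add: borel_prod)
qed

section \<open>The Lerch space in terms of the completed functions\<close>

definition Lerch_combination :: "complex \<Rightarrow> complex \<Rightarrow> complex \<Rightarrow> real \<times> real \<Rightarrow> complex" where
  "Lerch_combination s \<alpha> \<beta> = on_open_square (\<lambda>a c. \<alpha> * completed_Lerch 0 s a c + \<beta> * completed_Lerch 1 s a c)"

lemma Lerch_combination_measurable [measurable]: "Lerch_combination s \<alpha> \<beta> \<in> borel_measurable borel"
proof -
  note on_open_square_completed_Lerch_measurable[of 0 s, measurable] on_open_square_completed_Lerch_measurable[of 1 s, measurable]
  have "Lerch_combination s \<alpha> \<beta> = (\<lambda>x. \<alpha> * on_open_square (completed_Lerch 0 s) x + \<beta> * on_open_square (completed_Lerch 1 s) x)"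
    by (auto simp: fun_eq_iff Lerch_combination_def on_open_square_def)
  moreover have "(\<lambda>x. \<alpha> * on_open_square (completed_Lerch 0 s) x + \<beta> * on_open_square (completed_Lerch 1 s) x) \<in> borel_measurable borel"
    by measurable
  ultimately show ?thesis by simp
qed

lemma on_open_square_Lerch_plus:
  "on_open_square (\<lambda>a c. Lerch_plus s a c) = Lerch_combination s (Lerch_cofactor 0 s) 0"
  by (auto simp: fun_eq_iff on_open_square_def Lerch_combination_def Lerch_plus_eq)

lemma on_open_square_Lerch_minus:
  "on_open_square (\<lambda>a c. Lerch_minus s a c) = Lerch_combination s 0 (Lerch_cofactor 1 s)"
  by (auto simp: fun_eq_iff on_open_square_def Lerch_combination_def Lerch_minus_eq)

lemma on_open_square_Lerch_plus_dual:
  "on_open_square (\<lambda>a c. exp (- (2 * pi * \<i> * a * c)) * Lerch_plus (1 - s) (1 - c) a)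
     = Lerch_combination s (Lerch_cofactor 0 (1 - s)) 0"
proof -
  have "exp (- (2 * pi * \<i> * a * c)) * completed_Lerch 0 (1 - s) (1 - c) a = completed_Lerch 0 s a c" for a c
    using completed_Lerch_functional_equation[of 0 s a c] by simp
  then show ?thesis
    by (auto simp: fun_eq_iff on_open_square_def Lerch_combination_def Lerch_plus_eq mult.left_commute)
qed

lemma on_open_square_Lerch_minus_dual:
  "on_open_square (\<lambda>a c. exp (- (2 * pi * \<i> * a * c)) * Lerch_minus (1 - s) (1 - c) a)
     = Lerch_combination s 0 (- \<i> * Lerch_cofactor 1 (1 - s))"
proof -
  have "exp (- (2 * pi * \<i> * a * c)) * completed_Lerch 1 (1 - s) (1 - c) a
      = - \<i> * completed_Lerch 1 s a c" for a c
    by (subst completed_Lerch_functional_equation[of 1 s a c]) (simp flip: mult.assoc)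
  then show ?thesis
    by (auto simp: fun_eq_iff on_open_square_def Lerch_combination_def Lerch_minus_eq mult.left_commute)
qed

text \<open>Each generator is a multiple of one completed function, the dual ones by the functional
  equation, whose exponential matches theirs. The inclusion reduces statements about all members to
  statements about \<alpha> and \<beta>.\<close>

lemma Lerch_space_subset: "Lerch_space s \<subseteq> {Lerch_combination s \<alpha> \<beta> | \<alpha> \<beta>. True}"
proof -
  interpret vector_space fun_scale by (rule vector_space_fun_scale)
  let ?T = "{Lerch_combination s \<alpha> \<beta> | \<alpha> \<beta>. True}"
  have T: "Lerch_combination s \<alpha> \<beta> \<in> ?T" for \<alpha> \<beta> by blast
  have "subspace ?T"
  proof (rule subspaceI)
    have "0 = Lerch_combination s 0 0"
      by (auto simp: fun_eq_iff on_open_square_def Lerch_combination_def)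
    then show "0 \<in> ?T" using T by metis
  next
    fix x y assume "x \<in> ?T" "y \<in> ?T"
    then obtain \<alpha> \<beta> \<alpha>' \<beta>' where "x = Lerch_combination s \<alpha> \<beta>" "y = Lerch_combination s \<alpha>' \<beta>'" by blast
    then have "x + y = Lerch_combination s (\<alpha> + \<alpha>') (\<beta> + \<beta>')"
      by (auto simp: fun_eq_iff on_open_square_def Lerch_combination_def algebra_simps)
    then show "x + y \<in> ?T" using T by metis
  next
    fix r x assume "x \<in> ?T"
    then obtain \<alpha> \<beta> where "x = Lerch_combination s \<alpha> \<beta>" by blast
    then have "fun_scale r x = Lerch_combination s (r * \<alpha>) (r * \<beta>)"
      by (auto simp: fun_eq_iff on_open_square_def Lerch_combination_def fun_scale_def algebra_simps)
    then show "fun_scale r x \<in> ?T" using T by metis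
  qed
  then show ?thesis
    unfolding Lerch_space_def on_open_square_Lerch_plus on_open_square_Lerch_minus
      on_open_square_Lerch_plus_dual on_open_square_Lerch_minus_dual by (intro span_minimal) auto
qed

text \<open>Supplies the witness for the necessity of the strip. The cofactor at s can vanish at a
  pole of Gamma, but then Re s \<le> 0, so Re (1 - s) > 0 and the dual generator has a nonzero
  cofactor.\<close>

lemma Lerch_combination_plus_in_Lerch_space:
  obtains \<alpha> where "\<alpha> \<noteq> 0" "Lerch_combination s \<alpha> 0 \<in> Lerch_space s"
proof -
  interpret vector_space fun_scale by (rule vector_space_fun_scale)
  have "Lerch_combination s (Lerch_cofactor 0 s) 0 \<in> Lerch_space s"
    "Lerch_combination s (Lerch_cofactor 0 (1 - s)) 0 \<in> Lerch_space s"
    unfolding Lerch_space_def on_open_square_Lerch_plus[symmetric] on_open_square_Lerch_plus_dual[symmetric]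
    by (intro span_base; simp)+
  moreover have "Lerch_cofactor 0 s \<noteq> 0 \<or> Lerch_cofactor 0 (1 - s) \<noteq> 0"
  proof (cases "Re s > 0")
    case True
    then show ?thesis using Lerch_cofactor_mult_factor[of s 0] by auto
  next
    case False
    then show ?thesis using Lerch_cofactor_mult_factor[of "1 - s" 0] by auto
  qed
  ultimately show ?thesis using that by blast
qed

lemma lmeasurable_unit_square: "{0..1::real} \<times> {0..1::real} \<in> lmeasurable"
  using lmeasurable_cbox[of "(0, 0)" "(1::real, 1::real)"] by (simp add: cbox_Pair_eq)

text \<open>Because of the extension by zero, membership becomes integrability over the whole plane,
  which is a product space and thus open to Fubini.\<close>

lemma in_Lp_unit_square_iff:
  fixes f :: "real \<times> real \<Rightarrow> complex"
  assumes [measurable]: "f \<in> borel_measurable borel" and z: "\<And>x. x \<notin> {0..1} \<times> {0..1} \<Longrightarrow> f x = 0"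
  shows "in_Lp unit_square (ereal p) f \<longleftrightarrow> integrable lborel (\<lambda>x. norm (f x) powr p)"
proof -
  have "f \<in> borel_measurable lebesgue" by (rule measurable_completion) simp
  then have m: "f \<in> borel_measurable unit_square"
    unfolding unit_square_def by (rule measurable_restrict_space1)
  have S: "({0..1::real} \<times> {0..1::real}) \<inter> space lebesgue \<in> sets lebesgue"
    using fmeasurableD[OF lmeasurable_unit_square] by simp
  have "integrable unit_square (\<lambda>x. norm (f x) powr p) \<longleftrightarrow> integrable lebesgue (\<lambda>x. indicator ({0..1} \<times> {0..1}) x *\<^sub>R (norm (f x) powr p))"
    unfolding unit_square_def by (rule integrable_restrict_space[OF S])
  also have "(\<lambda>x. indicator ({0..1} \<times> {0..1}) x *\<^sub>R (norm (f x) powr p)) = (\<lambda>x. norm (f x) powr p)"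
  proof
    fix x
    show "indicator ({0..1} \<times> {0..1}) x *\<^sub>R (norm (f x) powr p) = norm (f x) powr p"
      using z[of x] by (cases "x \<in> {0..1} \<times> {0..1}") simp_all
  qed
  also have "integrable lebesgue (\<lambda>x. norm (f x) powr p) \<longleftrightarrow> integrable lborel (\<lambda>x. norm (f x) powr p)"
    by (rule integrable_completion) simp
  finally show ?thesis using m by (simp add: in_Lp_def)
qed

lemma Lerch_combination_in_Lp_iff:
  "in_Lp unit_square (ereal p) (Lerch_combination s \<alpha> \<beta>) \<longleftrightarrow> integrable lborel (\<lambda>x. norm (Lerch_combination s \<alpha> \<beta> x) powr p)"
  by (rule in_Lp_unit_square_iff[OF Lerch_combination_measurable]) (auto simp: Lerch_combination_def on_open_square_def split: if_splits)

lemma AE_lborel_unit_interval_ex: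
  assumes "AE x in lborel. P x"
  obtains x :: real where "0 < x" "x < 1" "P x"
proof -
  have "\<exists>x\<in>{0<..<1}. P x"
  proof (rule ccontr)
    assume "\<not> ?thesis"
    then have "AE x in lborel. x \<notin> {0<..<1::real}" using assms by (auto elim!: eventually_mono)
    then have "{0<..<1::real} \<in> null_sets lborel" by (subst AE_iff_null_sets) auto
    then show False by (simp add: null_sets_def)
  qed
  then show ?thesis using that by auto
qed

text \<open>The exponential of the functional equation has modulus 1, and i^k touches only the k = 1
  term. Slices in a at s thereby become slices in the second argument at 1 - s.\<close>

lemma norm_Lerch_combination_reflect:
  "norm (\<alpha> * completed_Lerch 0 s a c + \<beta> * completed_Lerch 1 s a c)
    = norm (\<alpha> * completed_Lerch 0 (1 - s) (1 - c) a + (\<i> * \<beta>) * completed_Lerch 1 (1 - s) (1 - c) a)"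
proof -
  have "\<alpha> * completed_Lerch 0 s a c + \<beta> * completed_Lerch 1 s a c
     = exp (- (2 * pi * \<i> * a * c)) * (\<alpha> * completed_Lerch 0 (1 - s) (1 - c) a + (\<i> * \<beta>) * completed_Lerch 1 (1 - s) (1 - c) a)"
    by (subst (1 2) completed_Lerch_functional_equation) (simp add: algebra_simps)
  then show ?thesis by (simp add: norm_mult)
qed

text \<open>By Fubini almost every slice of an integrable function is integrable, whereas here every
  slice in the right direction diverges: slices at fixed a if Re s \<ge> 1/p, and otherwise slices
  at fixed c, after passing to 1 - s.\<close>

proposition Lerch_combination_not_in_Lp:
  assumes p: "p \<ge> 1" "1 / p \<le> Re s \<or> Re s \<le> 1 - 1 / p" and nz: "\<alpha> \<noteq> 0 \<or> \<beta> \<noteq> 0"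
  shows "\<not> in_Lp unit_square (ereal p) (Lerch_combination s \<alpha> \<beta>)"
proof
  assume "in_Lp unit_square (ereal p) (Lerch_combination s \<alpha> \<beta>)"
  then have "integrable (lborel \<Otimes>\<^sub>M lborel) (\<lambda>x. norm (Lerch_combination s \<alpha> \<beta> x) powr p)"
    by (simp add: Lerch_combination_in_Lp_iff lborel_prod)
  then have int: "integrable (lborel \<Otimes>\<^sub>M lborel) (\<lambda>(a, c). norm (Lerch_combination s \<alpha> \<beta> (a, c)) powr p)"
    by (simp add: case_prod_beta')
  show False
  proof (cases "1 / p \<le> Re s")
    case True
    obtain a where a: "0 < a" "a < 1" and i: "integrable lborel (\<lambda>c. norm (Lerch_combination s \<alpha> \<beta> (a, c)) powr p)"
      by (rule AE_lborel_unit_interval_ex[OF lborel_pair.AE_integrable_fst[OF int]])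
    have "norm (Lerch_combination s \<alpha> \<beta> (a, c)) powr p = indicator {0<..<1} c * norm (\<alpha> * completed_Lerch 0 s a c + \<beta> * completed_Lerch 1 s a c) powr p" for c
      using a by (auto simp: Lerch_combination_def on_open_square_def indicator_def)
    with i show False using completed_Lerch_slice_not_integrable[OF p(1) True a nz] by simp
  next
    case False
    then have s': "1 / p \<le> Re (1 - s)" using p by simp
    obtain c where c: "0 < c" "c < 1" and i: "integrable lborel (\<lambda>a. norm (Lerch_combination s \<alpha> \<beta> (a, c)) powr p)"
      by (rule AE_lborel_unit_interval_ex[OF lborel_pair.AE_integrable_snd[OF int]])
    have "norm (Lerch_combination s \<alpha> \<beta> (a, c)) powr p = indicator {0<..<1} a *
        norm (\<alpha> * completed_Lerch 0 (1 - s) (1 - c) a + (\<i> * \<beta>) * completed_Lerch 1 (1 - s) (1 - c) a) powr p" for a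
      unfolding norm_Lerch_combination_reflect[of \<alpha> s a c \<beta>, symmetric]
      using c by (auto simp: Lerch_combination_def on_open_square_def indicator_def)
    with i show False
      using completed_Lerch_slice_not_integrable[OF p(1) s', of "1 - c" \<alpha> "\<i> * \<beta>"] c nz by simp
  qed
qed

section \<open>Integrability inside the strip\<close>

lemma integrable_product_lborel:
  fixes f g :: "real \<Rightarrow> real"
  assumes f: "integrable lborel f" and g: "integrable lborel g"
  shows "integrable lborel (\<lambda>x. f (fst x) * g (snd x))"
proof -
  have [measurable]: "f \<in> borel_measurable borel" "g \<in> borel_measurable borel"
    using assms by (simp_all add: borel_measurable_integrable)
  have "integrable (lborel \<Otimes>\<^sub>M lborel) (\<lambda>x. f (fst x) * g (snd x))"
  proof (rule lborel_pair.Fubini_integrable)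
    show "integrable lborel (\<lambda>x. \<integral>y. norm (f (fst (x, y)) * g (snd (x, y))) \<partial>lborel)"
      using f by (simp add: abs_mult)
  qed (use g in auto)
  then show ?thesis by (simp add: lborel_prod)
qed

lemma integrable_powr_unit_interval:
  fixes q :: real
  assumes "q < 1"
  shows "integrable lborel (\<lambda>x. indicator {0<..<1} x * x powr (- q))"
    and "integrable lborel (\<lambda>x. indicator {0<..<1} x * (1 - x) powr (- q))"
proof -
  have "(\<lambda>x. x powr (- q)) absolutely_integrable_on {0..1}"
    using assms by (intro nonnegative_absolutely_integrable_1 integrable_on_powr_from_0) auto
  then have "integrable lborel (\<lambda>x. indicator {0..1} x *\<^sub>R x powr (- q))"
    unfolding set_integrable_def by (subst (asm) integrable_completion) auto
  then have "integrable lborel (\<lambda>x. indicator {0<..<1} x *\<^sub>R (indicator {0..1} x *\<^sub>R x powr (- q)))"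
    by (rule integrable_mult_indicator[rotated]) simp
  then show *: "integrable lborel (\<lambda>x. indicator {0<..<1} x * x powr (- q))"
    by (rule Bochner_Integration.integrable_cong[OF refl, THEN iffD1, rotated]) (auto simp: indicator_def)
  have "integrable lborel (\<lambda>x. indicator {0<..<1} (1 + - 1 * x) * (1 + - 1 * x) powr (- q))"
    by (rule lborel_integrable_real_affine[OF *]) simp
  then show "integrable lborel (\<lambda>x. indicator {0<..<1} x * (1 - x) powr (- q))"
    by (rule Bochner_Integration.integrable_cong[OF refl, THEN iffD1, rotated]) (auto simp: indicator_def)
qed

text \<open>For 0 < Re s < 1 the uniform estimate applies to both halves, at s with (a, c) and at 1
  - s with (1 - c, a). The constant is therefore uniform on the whole square.\<close>

lemma completed_Lerch_bound:
  assumes s: "0 < Re s" "Re s < 1" and k: "k \<le> 1"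
  obtains C where "C \<ge> 0" "\<And>a c. 0 < a \<Longrightarrow> a < 1 \<Longrightarrow> 0 < c \<Longrightarrow> c < 1 \<Longrightarrow>
    norm (completed_Lerch k s a c) \<le> C * ((c powr (- Re s) + (1 - c) powr (- Re s)) + (a powr (- (1 - Re s)) + (1 - a) powr (- (1 - Re s))))"
proof -
  define K where "K = (\<lambda>s. (2 * exp 1 + theta_far) * Gamma ((Re s + k) / 2))"
  have one: "norm (half_mellin k ((s + of_nat k) / 2) a c) \<le> (norm (Lerch_factor k s) + \<bar>K s\<bar>) * (c powr (- Re s) + (1 - c) powr (- Re s))"
    if s: "Re s > 0" and c: "0 < c" "c < 1" for s a c
  proof -
    let ?X = "of_real c powr (- s) + (- 1) ^ k * exp (- (2 * pi * \<i> * a)) * of_real (1 - c) powr (- s)"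
    let ?Y = "c powr (- Re s) + (1 - c) powr (- Re s)"
    have X: "norm ?X \<le> ?Y"
      using c by (intro order.trans[OF norm_triangle_ineq] add_mono)
        (simp_all add: norm_mult norm_power norm_powr_real_powr norm_exp_eq_Re del: of_real_diff)
    \<comment> \<open>The powers are at least 1, so the additive error can be absorbed into a
      multiple of them.\<close>
    have "1 = 1 powr (- Re s)" by simp
    also have "\<dots> \<le> c powr (- Re s)" using c s by (intro powr_mono2') auto
    finally have Y: "1 \<le> ?Y" by (simp add: add_increasing2)
    have "norm (half_mellin k ((s + of_nat k) / 2) a c) \<le> norm (half_mellin k ((s + of_nat k) / 2) a c - Lerch_factor k s * ?X) + norm (Lerch_factor k s * ?X)"
      using norm_triangle_ineq[of "half_mellin k ((s + of_nat k) / 2) a c - Lerch_factor k s * ?X" "Lerch_factor k s * ?X"] by simp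
    also have "\<dots> \<le> \<bar>K s\<bar> * ?Y + norm (Lerch_factor k s) * ?Y"
    proof (rule add_mono)
      have "norm (half_mellin k ((s + of_nat k) / 2) a c - Lerch_factor k s * ?X) \<le> K s"
        unfolding K_def by (rule half_mellin_asymp[OF s k c])
      also have "\<dots> \<le> \<bar>K s\<bar> * 1" by simp
      also have "\<dots> \<le> \<bar>K s\<bar> * ?Y" using Y by (intro mult_left_mono) auto
      finally show "norm (half_mellin k ((s + of_nat k) / 2) a c - Lerch_factor k s * ?X) \<le> \<bar>K s\<bar> * ?Y" .
      show "norm (Lerch_factor k s * ?X) \<le> norm (Lerch_factor k s) * ?Y"
        unfolding norm_mult using X by (intro mult_left_mono) auto
    qed
    finally show ?thesis by (simp add: algebra_simps)
  qed
  define C1 where "C1 = norm (Lerch_factor k s) + \<bar>K s\<bar>"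
  define C2 where "C2 = norm (Lerch_factor k (1 - s)) + \<bar>K (1 - s)\<bar>"
  show ?thesis
  proof
    show "0 \<le> C1 + C2" by (simp add: C1_def C2_def)
    fix a c :: real assume a: "0 < a" "a < 1" and c: "0 < c" "c < 1"
    let ?Y = "c powr (- Re s) + (1 - c) powr (- Re s)"
    let ?Z = "a powr (- (1 - Re s)) + (1 - a) powr (- (1 - Re s))"
    have "norm (completed_Lerch k s a c) \<le> norm (half_mellin k ((s + of_nat k) / 2) a c) + norm (half_mellin k ((1 - s + of_nat k) / 2) (1 - c) a)"
      unfolding completed_Lerch_def by (rule order.trans[OF norm_triangle_ineq]) (simp add: norm_mult norm_power)
    also have "\<dots> \<le> C1 * ?Y + C2 * ?Z"
      unfolding C1_def C2_def using one[OF s(1) c, of a] one[of "1 - s", OF _ a, of "1 - c"] s by (intro add_mono) simp_all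
    also have "\<dots> \<le> (C1 + C2) * (?Y + ?Z)"
      by (simp add: algebra_simps C1_def C2_def)
    finally show "norm (completed_Lerch k s a c) \<le> (C1 + C2) * (?Y + ?Z)" .
  qed
qed

text \<open>The p-th powers of the four singular terms have exponents p Re s and p (1 - Re s), and
  both are below 1 exactly in the strip.\<close>

proposition Lerch_combination_in_Lp:
  assumes p: "p \<ge> 1" and s: "1 - 1 / p < Re s" "Re s < 1 / p"
  shows "in_Lp unit_square (ereal p) (Lerch_combination s \<alpha> \<beta>)"
proof -
  have "1 / p \<le> 1" using p by simp
  then have s01: "0 < Re s" "Re s < 1" using s by linarith+
  define q where "q = Re s * p"
  define r where "r = (1 - Re s) * p"
  have q: "q < 1" using s p by (simp add: q_def field_simps)
  have "1 - Re s < 1 / p" using s by simp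
  then have r: "r < 1" using p by (simp add: r_def field_simps)
  obtain C0 where C0: "C0 \<ge> 0" "\<And>a c. 0 < a \<Longrightarrow> a < 1 \<Longrightarrow> 0 < c \<Longrightarrow> c < 1 \<Longrightarrow>
    norm (completed_Lerch 0 s a c) \<le> C0 * ((c powr (- Re s) + (1 - c) powr (- Re s)) + (a powr (- (1 - Re s)) + (1 - a) powr (- (1 - Re s))))"
    using completed_Lerch_bound[OF s01, of 0] by auto
  obtain C1 where C1: "C1 \<ge> 0" "\<And>a c. 0 < a \<Longrightarrow> a < 1 \<Longrightarrow> 0 < c \<Longrightarrow> c < 1 \<Longrightarrow>
    norm (completed_Lerch 1 s a c) \<le> C1 * ((c powr (- Re s) + (1 - c) powr (- Re s)) + (a powr (- (1 - Re s)) + (1 - a) powr (- (1 - Re s))))"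
    using completed_Lerch_bound[OF s01, of 1] by auto
  define C where "C = norm \<alpha> * C0 + norm \<beta> * C1"
  have Cn: "C \<ge> 0" using C0(1) C1(1) by (simp add: C_def)
  let ?I = "indicator {0<..<1} :: real \<Rightarrow> real"
  \<comment> \<open>Each summand is an integrable function of one variable times the indicator of
    the unit interval in the other.\<close>
  define H where "H = (\<lambda>x. (?I (fst x) * (?I (snd x) * snd x powr (- q)) + ?I (fst x) * (?I (snd x) * (1 - snd x) powr (- q)))
     + ((?I (fst x) * fst x powr (- r)) * ?I (snd x) + (?I (fst x) * (1 - fst x) powr (- r)) * ?I (snd x)))"
  have I: "integrable lborel ?I" by simp
  have "integrable lborel H"
    unfolding H_def by (intro Bochner_Integration.integrable_add integrable_product_lborel
        integrable_powr_unit_interval q r I)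
  \<comment> \<open>\<open>C powr p\<close> comes from the pointwise bound, and one factor
    \<open>2 powr p\<close> from each of the two nested uses of \<open>add_powr_le\<close> on four
    summands.\<close>
  then have i1: "integrable lborel (\<lambda>x. C powr p * (2 powr p * (2 powr p * H x)))"
    by (intro integrable_mult_right)
  have i2: "AE x in lborel. norm (norm (Lerch_combination s \<alpha> \<beta> x) powr p) \<le> norm (C powr p * (2 powr p * (2 powr p * H x)))"
  proof (intro AE_I2)
    fix x :: "real \<times> real"
    obtain a c where x: "x = (a, c)" by (cases x)
    have H0: "H x \<ge> 0" by (simp add: H_def)
    show "norm (norm (Lerch_combination s \<alpha> \<beta> x) powr p) \<le> norm (C powr p * (2 powr p * (2 powr p * H x)))"
    proof (cases "0 < a \<and> a < 1 \<and> 0 < c \<and> c < 1")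
      case True
      let ?Y1 = "c powr (- Re s)" and ?Y2 = "(1 - c) powr (- Re s)"
      let ?Z1 = "a powr (- (1 - Re s))" and ?Z2 = "(1 - a) powr (- (1 - Re s))"
      let ?B = "(?Y1 + ?Y2) + (?Z1 + ?Z2)"
      have "norm (Lerch_combination s \<alpha> \<beta> x) \<le> norm \<alpha> * norm (completed_Lerch 0 s a c) + norm \<beta> * norm (completed_Lerch 1 s a c)"
        unfolding x Lerch_combination_def on_open_square_def using True
        by (auto simp flip: norm_mult intro: norm_triangle_ineq)
      also have "\<dots> \<le> norm \<alpha> * (C0 * ?B) + norm \<beta> * (C1 * ?B)"
        using True by (intro add_mono mult_left_mono C0(2) C1(2)) auto
      also have "\<dots> = C * ?B" by (simp add: C_def algebra_simps)
      finally have "norm (Lerch_combination s \<alpha> \<beta> x) powr p \<le> (C * ?B) powr p"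
        using p by (intro powr_mono2) auto
      also have "\<dots> = C powr p * ?B powr p" using Cn by (simp add: powr_mult)
      also have "?B powr p \<le> 2 powr p * ((?Y1 + ?Y2) powr p + (?Z1 + ?Z2) powr p)"
        using p by (intro add_powr_le) auto
      also have "\<dots> \<le> 2 powr p * (2 powr p * (?Y1 powr p + ?Y2 powr p) + 2 powr p * (?Z1 powr p + ?Z2 powr p))"
        using p by (intro mult_left_mono add_mono add_powr_le) auto
      also have "\<dots> = 2 powr p * (2 powr p * H x)"
        using True by (simp add: H_def x powr_powr q_def r_def algebra_simps)
      finally show ?thesis using H0 by (simp add: mult_left_mono)
    next
      case False
      then show ?thesis using H0 by (auto simp: x Lerch_combination_def on_open_square_def)
    qed
  qed
  have "integrable lborel (\<lambda>x. norm (Lerch_combination s \<alpha> \<beta> x) powr p)"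
    by (rule Bochner_Integration.integrable_bound[OF i1 _ i2]) measurable
  then show ?thesis unfolding Lerch_combination_in_Lp_iff .
qed

text \<open>The square has finite measure, so an essentially bounded function is square integrable;
  this reduces the exponent \<infinity> to the exponent 2.\<close>

lemma in_Lp_infinity_imp_in_Lp_2:
  assumes "in_Lp unit_square \<infinity> f"
  shows "in_Lp unit_square (ereal 2) f"
proof -
  obtain C where m [measurable]: "f \<in> borel_measurable unit_square" and C: "AE x in unit_square. norm (f x) \<le> C"
    using assms by (auto simp: in_Lp_def)
  interpret finite_measure unit_square
    unfolding unit_square_def by (rule finite_measure_lebesgue_on) (rule lmeasurable_unit_square)
  have "integrable unit_square (\<lambda>x. norm (f x) powr 2)"
  proof (rule integrable_const_bound[where B = "C powr 2"])
    show "AE x in unit_square. norm (norm (f x) powr 2) \<le> C powr 2"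
      using C by eventually_elim (simp only: real_norm_def abs_of_nonneg[OF powr_ge_zero], intro powr_mono2, auto)
  qed measurable
  then show ?thesis using m by (simp add: in_Lp_def)
qed

lemma Lerch_space_not_in_Lp:
  assumes p: "p \<ge> 1" "1 / p \<le> Re s \<or> Re s \<le> 1 - 1 / p" and f: "f \<in> Lerch_space s" "f \<noteq> 0"
  shows "\<not> in_Lp unit_square (ereal p) f"
proof -
  obtain \<alpha> \<beta> where ab: "f = Lerch_combination s \<alpha> \<beta>" using Lerch_space_subset f(1) by blast
  have "\<alpha> \<noteq> 0 \<or> \<beta> \<noteq> 0"
    using f(2) unfolding ab by (auto simp: fun_eq_iff Lerch_combination_def on_open_square_def split: if_splits)
  then show ?thesis unfolding ab using p by (intro Lerch_combination_not_in_Lp)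
qed

theorem theorem2p4:
  fixes s :: complex
  shows "(\<forall>p::real. 1 \<le> p \<and> p < 2 \<longrightarrow>
            ((\<forall>f\<in>Lerch_space s. in_Lp unit_square (ereal p) f)
               \<longleftrightarrow> 1 - 1 / p < Re s \<and> Re s < 1 / p) \<and>
            (\<not> (1 - 1 / p < Re s \<and> Re s < 1 / p) \<longrightarrow>
               (\<forall>f\<in>Lerch_space s. f \<noteq> 0 \<longrightarrow> \<not> in_Lp unit_square (ereal p) f)))
       \<and> (\<forall>p::ereal. 2 \<le> p \<longrightarrow>
            (\<forall>f\<in>Lerch_space s. f \<noteq> 0 \<longrightarrow> \<not> in_Lp unit_square p f))"
proof (intro conjI allI impI ballI)
  fix p :: real assume p: "1 \<le> p \<and> p < 2"
  show "(\<forall>f\<in>Lerch_space s. in_Lp unit_square (ereal p) f) \<longleftrightarrow> 1 - 1 / p < Re s \<and> Re s < 1 / p"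
  proof
    assume all: "\<forall>f\<in>Lerch_space s. in_Lp unit_square (ereal p) f"
    obtain \<alpha> where "\<alpha> \<noteq> 0" "Lerch_combination s \<alpha> 0 \<in> Lerch_space s"
      by (rule Lerch_combination_plus_in_Lerch_space)
    then show "1 - 1 / p < Re s \<and> Re s < 1 / p"
      using all Lerch_combination_not_in_Lp[of p s \<alpha> 0] p by (meson not_le)
  next
    assume "1 - 1 / p < Re s \<and> Re s < 1 / p"
    then show "\<forall>f\<in>Lerch_space s. in_Lp unit_square (ereal p) f"
      using Lerch_space_subset[of s] Lerch_combination_in_Lp[of p s] p by blast
  qed
next
  fix p :: real and f assume "1 \<le> p \<and> p < 2" "\<not> (1 - 1 / p < Re s \<and> Re s < 1 / p)" "f \<in> Lerch_space s" "f \<noteq> 0"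
  then show "\<not> in_Lp unit_square (ereal p) f"
    by (intro Lerch_space_not_in_Lp) auto
next
  fix p :: ereal and f assume p: "2 \<le> p" and f: "f \<in> Lerch_space s" "f \<noteq> 0"
  have real: "\<not> in_Lp unit_square (ereal r) f" if "2 \<le> r" for r
  proof -
    \<comment> \<open>For r \<ge> 2 the strip is empty, since 1/r \<le> 1/2 \<le> 1 - 1/r; the two
      half-planes of divergence cover the plane.\<close>
    have "1 / r \<le> 1 / 2" using that by (intro divide_left_mono) auto
    then have "1 / r \<le> Re s \<or> Re s \<le> 1 - 1 / r" by linarith
    then show ?thesis using that f by (intro Lerch_space_not_in_Lp) auto
  qed
  show "\<not> in_Lp unit_square p f"
  proof (cases p)
    case (real r)
    then show ?thesis using p \<open>\<And>r. 2 \<le> r \<Longrightarrow> \<not> in_Lp unit_square (ereal r) f\<close> by simp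
  next
    case PInf
    then show ?thesis using in_Lp_infinity_imp_in_Lp_2[of f] real[of 2] by auto
  next
    case MInf
    then show ?thesis using p by simp
  qed
qed

end
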